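(* For every integer $n\geq 1$ and every prime $p$, the fixed field $\mathbb{C}(x_1,\dots,x_{np})^{K_{n,p}}$, where $K_{n,p}$ acts on $\mathbb{C}(x_1,\dots,x_{np})$ by $\mathbb{C}$-automorphisms permuting the variables, is rational over $\mathbb{C}$.
   Context: A field extension $K/\mathbb{C}$ is rational if it is a finitely generated purely transcendental extension of $\mathbb{C}$. The wreath product $\Sigma_n\wr\mathbb{Z}/p$ is the semidirect product $\Sigma_n\ltimes(\mathbb{Z}/p)^n$, where the symmetric group $\Sigma_n$ acts on $(\mathbb{Z}/p)^n$ by permutation of factors; its elements are written $(a_1,\dots,a_n;\tau)$ with $a_i\in\mathbb{Z}/p$, $\tau\in\Sigma_n$. It is regarded as a subgroup of the group of permutations of $\{1,\dots,np\}$ as follows: split $\{1,\dots,np\}$ into the $n$ consecutive blocks $\{(j-1)p+1,\dots,jp\}$, $j=1,\dots,n$; the generator of the $j$-th factor of $(\mathbb{Z}/p)^n$ acts as the $p$-cycle $(j-1)p+1\mapsto (j-1)p+2\mapsto\dots\mapsto jp\mapsto (j-1)p+1$ and fixes all other elements, and $\tau\in\Sigma_n$ permutes the blocks, $(j-1)p+r\mapsto(\tau(j)-1)p+r$ for $1\leq r\leq p$. Let $\phi:\Sigma_n\wr\mathbb{Z}/p\to\mathbb{Z}/p$ be the homomorphism $\phi(a_1,\dots,a_n;\tau)=\sum_{i=1}^n a_i$, and let $K_{n,p}=\operatorname{Ker}(\phi)$. *)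

theory Defs
  imports
    "HOL-Library.Poly_Mapping"
    "HOL-Algebra.Sym_Groups"
    "HOL-Algebra.Elementary_Groups"
    "HOL-Algebra.Product_Groups"
    "HOL-Algebra.Generated_Fields"
    "HOL-Algebra.Algebraic_Closure_Type"
    "HOL-Computational_Algebra.Primes"
    "HOL-Computational_Algebra.Fraction_Field"
    Complex_Main
begin

section \<open>Field extensions\<close>

text \<open>
  Extensions of a field \<open>k\<close> are the intermediate fields of an ambient field given by a type
  \<open>'a\<close> together with an embedding \<open>\<iota>\<close> of \<open>k\<close> into it.
\<close>

definition adjoin :: "('k \<Rightarrow> 'a) \<Rightarrow> 'a set \<Rightarrow> 'a::field set" where
  "adjoin \<iota> S = generate_field ring_of_type_algebra (range \<iota> \<union> S)"

lemma adjoin_type_algebra: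
  fixes x y :: "'a::field"
  shows "x \<oplus>\<^bsub>ring_of_type_algebra\<^esub> y = x + y" "x \<otimes>\<^bsub>ring_of_type_algebra\<^esub> y = x * y"
    "\<one>\<^bsub>ring_of_type_algebra\<^esub> = (1::'a)" "\<zero>\<^bsub>ring_of_type_algebra\<^esub> = (0::'a)"
    "\<ominus>\<^bsub>ring_of_type_algebra\<^esub> x = - x"
    "x \<noteq> 0 \<Longrightarrow> inv\<^bsub>ring_of_type_algebra\<^esub> x = inverse x"
proof -
  interpret R: field "ring_of_type_algebra :: 'a ring" by (rule field_from_type_algebra)
  show *: "x \<oplus>\<^bsub>ring_of_type_algebra\<^esub> y = x + y" "x \<otimes>\<^bsub>ring_of_type_algebra\<^esub> y = x * y"
    "\<one>\<^bsub>ring_of_type_algebra\<^esub> = (1::'a)" "\<zero>\<^bsub>ring_of_type_algebra\<^esub> = (0::'a)" for x y :: 'a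
    by (simp_all add: ring_of_type_algebra_def)
  have c: "carrier ring_of_type_algebra = (UNIV :: 'a set)" by (simp add: ring_of_type_algebra_def)
  show "\<ominus>\<^bsub>ring_of_type_algebra\<^esub> x = - x"
    using R.minus_equality[of "-x" x] by (simp add: * c)
  show "x \<noteq> 0 \<Longrightarrow> inv\<^bsub>ring_of_type_algebra\<^esub> x = inverse x"
    using R.comm_inv_char[of x "inverse x"] by (simp add: * c)
qed

lemma adjoin_eq_Inter:
  "adjoin \<iota> S =
     \<Inter>{F. range \<iota> \<union> S \<subseteq> F \<and> 1 \<in> F \<and> (\<forall>x\<in>F. - x \<in> F \<and> inverse x \<in> F) \<and>
          (\<forall>x\<in>F. \<forall>y\<in>F. x + y \<in> F \<and> x * y \<in> F)}" (is "_ = \<Inter>?\<F>")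
proof
  show "adjoin \<iota> S \<subseteq> \<Inter>?\<F>"
  proof
    fix x assume "x \<in> adjoin \<iota> S"
    then have "x \<in> generate_field ring_of_type_algebra (range \<iota> \<union> S)" by (simp add: adjoin_def)
    then show "x \<in> \<Inter>?\<F>"
      by (induction rule: generate_field.induct) (auto simp: adjoin_type_algebra)
  qed
  let ?G = "generate_field ring_of_type_algebra (range \<iota> \<union> S)"
  have z: "0 \<in> ?G"
    using generate_field.one[of ring_of_type_algebra "range \<iota> \<union> S"]
      generate_field.a_inv[OF generate_field.one[of ring_of_type_algebra "range \<iota> \<union> S"]]
      generate_field.eng_add[of 1 ring_of_type_algebra "range \<iota> \<union> S" "-1"]
    by (simp add: adjoin_type_algebra)
  have "adjoin \<iota> S \<in> ?\<F>"
    unfolding adjoin_def mem_Collect_eq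
  proof (intro conjI ballI)
    show "inverse x \<in> ?G" if "x \<in> ?G" for x
      using generate_field.m_inv[OF that] z by (cases "x = 0") (auto simp: adjoin_type_algebra)
    show "range \<iota> \<union> S \<subseteq> ?G" by (auto intro: generate_field.incl)
    show "1 \<in> ?G"
      using generate_field.one[of ring_of_type_algebra "range \<iota> \<union> S"]
      by (simp add: adjoin_type_algebra)
    show "- x \<in> ?G" if "x \<in> ?G" for x
      using generate_field.a_inv[OF that] by (simp add: adjoin_type_algebra)
    show "x + y \<in> ?G" if "x \<in> ?G" "y \<in> ?G" for x y
      using generate_field.eng_add[OF that] by (simp add: adjoin_type_algebra)
    show "x * y \<in> ?G" if "x \<in> ?G" "y \<in> ?G" for x y
      using generate_field.eng_mult[OF that] by (simp add: adjoin_type_algebra)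
  qed
  then show "\<Inter>?\<F> \<subseteq> adjoin \<iota> S" by blast
qed

text \<open>
  A polynomial with variables in \<open>'v\<close> and coefficients in \<open>'k\<close> has type
  \<open>('v \<Rightarrow>\<^sub>0 nat) \<Rightarrow>\<^sub>0 'k\<close>; it maps exponent vectors to coefficients.
\<close>

definition mpoly_eval ::
  "('k::zero \<Rightarrow> 'a) \<Rightarrow> ('v \<Rightarrow> 'a) \<Rightarrow> (('v \<Rightarrow>\<^sub>0 nat) \<Rightarrow>\<^sub>0 'k) \<Rightarrow> 'a::comm_ring_1" where
  "mpoly_eval \<iota> v P =
     (\<Sum>m\<in>Poly_Mapping.keys P. \<iota> (Poly_Mapping.lookup P m) *
        (\<Prod>i\<in>Poly_Mapping.keys m. v i ^ Poly_Mapping.lookup m i))"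

lemma mpoly_eval_add:
  assumes "\<iota> 0 = 0" "\<And>a b. \<iota> (a + b) = \<iota> a + \<iota> b"
  shows "mpoly_eval \<iota> v (P + Q) = mpoly_eval \<iota> v P + mpoly_eval \<iota> v Q"
  unfolding mpoly_eval_def
  by (rule setsum_keys_plus_distrib) (simp_all add: assms distrib_right)

lemma mpoly_eval_single:
  assumes "\<iota> 0 = 0"
  shows "mpoly_eval \<iota> v (Poly_Mapping.single m c) =
     \<iota> c * (\<Prod>i\<in>Poly_Mapping.keys m. v i ^ Poly_Mapping.lookup m i)"
  by (cases "c = 0") (simp_all add: mpoly_eval_def assms)

lemma mpoly_eval_zero: "mpoly_eval \<iota> v 0 = 0"
  by (simp add: mpoly_eval_def)

lemma mpoly_eval_sum:
  assumes "\<iota> 0 = 0" "\<And>a b. \<iota> (a + b) = \<iota> a + \<iota> b"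
  shows "mpoly_eval \<iota> v (\<Sum>x\<in>A. f x) = (\<Sum>x\<in>A. mpoly_eval \<iota> v (f x))"
  by (induction A rule: infinite_finite_induct)
    (simp_all add: mpoly_eval_zero mpoly_eval_add[of \<iota>, OF assms])

lemma mpoly_as_sum:
  "(\<Sum>m\<in>Poly_Mapping.keys P. Poly_Mapping.single m (Poly_Mapping.lookup P m)) = P"
  by (rule poly_mapping_eqI)
    (auto simp: lookup_sum lookup_single when_def not_in_keys_iff_lookup_eq_zero)

lemma monomial_add:
  fixes v :: "'v \<Rightarrow> 'a::comm_ring_1"
  shows "(\<Prod>i\<in>Poly_Mapping.keys (m + m'). v i ^ Poly_Mapping.lookup (m + m') i) =
    (\<Prod>i\<in>Poly_Mapping.keys m. v i ^ Poly_Mapping.lookup m i) *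
    (\<Prod>i\<in>Poly_Mapping.keys m'. v i ^ Poly_Mapping.lookup m' i)"
proof -
  have *: "(\<Prod>i\<in>Poly_Mapping.keys k. v i ^ Poly_Mapping.lookup k i) =
      (\<Prod>i\<in>Poly_Mapping.keys m \<union> Poly_Mapping.keys m'. v i ^ Poly_Mapping.lookup k i)"
    if "Poly_Mapping.keys k \<subseteq> Poly_Mapping.keys m \<union> Poly_Mapping.keys m'" for k
    using that by (intro prod.mono_neutral_left) (auto simp: in_keys_iff)
  show ?thesis
    by (subst (1 2 3) *) (auto simp: lookup_add power_add prod.distrib dest: keys_add[THEN subsetD])
qed

lemma mpoly_eval_mult:
  fixes P Q :: "('v \<Rightarrow>\<^sub>0 nat) \<Rightarrow>\<^sub>0 'k::comm_semiring_1"
  assumes "\<iota> 0 = 0" "\<And>a b. \<iota> (a + b) = \<iota> a + \<iota> b" "\<And>a b. \<iota> (a * b) = \<iota> a * \<iota> b"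
  shows "mpoly_eval \<iota> v (P * Q) = mpoly_eval \<iota> v P * mpoly_eval \<iota> v Q"
proof -
  let ?s = "\<lambda>P m. Poly_Mapping.single m (Poly_Mapping.lookup P m)"
  have "P * Q = (\<Sum>m\<in>Poly_Mapping.keys P. \<Sum>m'\<in>Poly_Mapping.keys Q. ?s P m * ?s Q m')"
    by (simp only: sum_product[symmetric] mpoly_as_sum)
  also have "mpoly_eval \<iota> v \<dots> = 
     (\<Sum>m\<in>Poly_Mapping.keys P. \<Sum>m'\<in>Poly_Mapping.keys Q. mpoly_eval \<iota> v (?s P m) * mpoly_eval \<iota> v (?s Q m'))"
    by (simp add: mpoly_eval_sum[of \<iota>, OF assms(1,2)] mult_single mpoly_eval_single[of \<iota>, OF assms(1)] 
         assms(3) monomial_add mult_ac)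
  also have "\<dots> = mpoly_eval \<iota> v P * mpoly_eval \<iota> v Q"
    by (simp only: sum_product[symmetric] mpoly_eval_sum[of \<iota>, OF assms(1,2), symmetric] mpoly_as_sum)
  finally show ?thesis .
qed

text \<open>The elements of \<open>B\<close> themselves serve as the names of the variables.\<close>

definition alg_independent :: "('k::zero \<Rightarrow> 'a::field) \<Rightarrow> 'a set \<Rightarrow> bool" where
  "alg_independent \<iota> B \<longleftrightarrow>
     (\<forall>P :: ('a \<Rightarrow>\<^sub>0 nat) \<Rightarrow>\<^sub>0 'k.
        (\<forall>m\<in>Poly_Mapping.keys P. Poly_Mapping.keys m \<subseteq> B) \<and> mpoly_eval \<iota> (\<lambda>b. b) P = 0
        \<longrightarrow> P = 0)"

definition finitely_generated_extension :: "('k \<Rightarrow> 'a::field) \<Rightarrow> 'a set \<Rightarrow> bool" where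
  "finitely_generated_extension \<iota> K \<longleftrightarrow> (\<exists>S. finite S \<and> K = adjoin \<iota> S)"

definition purely_transcendental_extension :: "('k::zero \<Rightarrow> 'a::field) \<Rightarrow> 'a set \<Rightarrow> bool" where
  "purely_transcendental_extension \<iota> K \<longleftrightarrow> (\<exists>B. alg_independent \<iota> B \<and> K = adjoin \<iota> B)"

definition rational_extension :: "('k::zero \<Rightarrow> 'a::field) \<Rightarrow> 'a set \<Rightarrow> bool" where
  "rational_extension \<iota> K \<longleftrightarrow>
     finitely_generated_extension \<iota> K \<and> purely_transcendental_extension \<iota> K"


section \<open>Rational functions over the complex numbers\<close>

text \<open>
  The ambient field is the field of rational functions in countably many variables, so that all
  the fields \<open>\<complex>(x\<^sub>1, \<dots>, x\<^sub>N)\<close> live in one type. The variable \<open>x\<^sub>i\<close> is \<open>rf_var i\<close>.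
\<close>

type_synonym ratfun = "((nat \<Rightarrow>\<^sub>0 nat) \<Rightarrow>\<^sub>0 complex) fract"

definition rf_const :: "complex \<Rightarrow> ratfun" where
  "rf_const c = Fraction_Field.Fract (Poly_Mapping.single 0 c) 1"

definition rf_var :: "nat \<Rightarrow> ratfun" where
  "rf_var i = Fraction_Field.Fract (Poly_Mapping.single (Poly_Mapping.single i 1) 1) 1"

definition rf_field :: "nat \<Rightarrow> ratfun set" where
  "rf_field N = adjoin rf_const (rf_var ` {1..N})"

text \<open>
  The substitution \<open>x\<^sub>i \<mapsto> x\<^bsub>\<sigma> i\<^esub>\<close>; for injective \<open>\<sigma>\<close> it does not depend on the
  representation as a fraction, see \<open>perm_act_Fract\<close>.
\<close>

definition perm_act :: "(nat \<Rightarrow> nat) \<Rightarrow> ratfun \<Rightarrow> ratfun" where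
  "perm_act \<sigma> f =
     (THE g. \<exists>P Q. Q \<noteq> 0 \<and> f = Fraction_Field.Fract P Q \<and>
        g = mpoly_eval rf_const (\<lambda>i. rf_var (\<sigma> i)) P / mpoly_eval rf_const (\<lambda>i. rf_var (\<sigma> i)) Q)"

lemma rf_const_hom:
  "rf_const 0 = 0" "rf_const 1 = 1" "rf_const (a + b) = rf_const a + rf_const b"
  "rf_const (a * b) = rf_const a * rf_const b" 
  by (simp_all add: rf_const_def Zero_fract_def One_fract_def single_add mult_single)

lemma Fract_1_power: "Fraction_Field.Fract a 1 ^ k = Fraction_Field.Fract (a ^ k) 1"
  by (induction k) (simp_all add: One_fract_def)

lemma Fract_1_prod: "(\<Prod>i\<in>A. Fraction_Field.Fract (f i) 1) = Fraction_Field.Fract (\<Prod>i\<in>A. f i) 1"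
  by (induction A rule: infinite_finite_induct) (simp_all add: One_fract_def)

lemma Fract_1_sum: "(\<Sum>i\<in>A. Fraction_Field.Fract (f i) 1) = Fraction_Field.Fract (\<Sum>i\<in>A. f i) 1"
  by (induction A rule: infinite_finite_induct) (simp_all add: Zero_fract_def)

lemma single_power_nat:
  "Poly_Mapping.single (Poly_Mapping.single i (1::nat)) (1::complex) ^ k = Poly_Mapping.single (Poly_Mapping.single i k) 1"
  by (induction k) (simp_all add: mult_single single_add[symmetric])

lemma prod_single:
  "finite A \<Longrightarrow> (\<Prod>i\<in>A. Poly_Mapping.single (g i) (1::complex)) = Poly_Mapping.single (\<Sum>i\<in>A. g i) 1"
  by (induction A rule: finite_induct) (simp_all add: mult_single)

lemma mpoly_eval_rename:
  "mpoly_eval rf_const (\<lambda>i. rf_var (\<sigma> i)) P = Fraction_Field.Fract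
     (\<Sum>m\<in>Poly_Mapping.keys P. Poly_Mapping.single
        (\<Sum>i\<in>Poly_Mapping.keys m. Poly_Mapping.single (\<sigma> i) (Poly_Mapping.lookup m i)) (Poly_Mapping.lookup P m)) 1"
  by (simp add: mpoly_eval_def rf_const_def rf_var_def Fract_1_power Fract_1_prod single_power_nat prod_single
      mult_single Fract_1_sum flip: One_nat_def)

lemma mpoly_eval_id: "mpoly_eval rf_const rf_var P = Fraction_Field.Fract P 1"
  using mpoly_eval_rename[of "\<lambda>i. i" P] by (simp add: mpoly_as_sum)

lemma mpoly_eval_rename_eq_0_iff:
  fixes \<sigma> :: "nat \<Rightarrow> nat"
  assumes "inj \<sigma>"
  shows "mpoly_eval rf_const (\<lambda>i. rf_var (\<sigma> i)) P = 0 \<longleftrightarrow> P = 0"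
proof
  let ?r = "\<lambda>m::nat \<Rightarrow>\<^sub>0 nat. \<Sum>i\<in>Poly_Mapping.keys m. Poly_Mapping.single (\<sigma> i) (Poly_Mapping.lookup m i)"
  have r: "Poly_Mapping.lookup (?r m) (\<sigma> i) = Poly_Mapping.lookup m i" for m i
    using assms by (auto simp: lookup_sum lookup_single when_def inj_eq not_in_keys_iff_lookup_eq_zero)
  have inj: "?r m = ?r m' \<longleftrightarrow> m = m'" for m m'
    using r[of m] r[of m'] by (metis poly_mapping_eqI)
  assume "mpoly_eval rf_const (\<lambda>i. rf_var (\<sigma> i)) P = 0"
  then have *: "(\<Sum>m\<in>Poly_Mapping.keys P. Poly_Mapping.single (?r m) (Poly_Mapping.lookup P m)) = 0"
    by (simp add: mpoly_eval_rename Zero_fract_def eq_fract)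
  have "Poly_Mapping.lookup P k = 0" for k
    using arg_cong[OF *, of "\<lambda>p. Poly_Mapping.lookup p (?r k)"]
    by (auto simp: lookup_sum lookup_single when_def inj not_in_keys_iff_lookup_eq_zero split: if_splits)
  then show "P = 0" by (simp add: poly_mapping_eqI)
qed (simp add: mpoly_eval_zero)

lemma perm_act_Fract:
  assumes "inj \<sigma>" "Q \<noteq> 0"
  shows "perm_act \<sigma> (Fraction_Field.Fract P Q) =
    mpoly_eval rf_const (\<lambda>i. rf_var (\<sigma> i)) P / mpoly_eval rf_const (\<lambda>i. rf_var (\<sigma> i)) Q"
  unfolding perm_act_def
proof (rule the_equality)
  let ?e = "mpoly_eval rf_const (\<lambda>i. rf_var (\<sigma> i))"
  fix g
  assume "\<exists>P' Q'. Q' \<noteq> 0 \<and> Fraction_Field.Fract P Q = Fraction_Field.Fract P' Q' \<and> g = ?e P' / ?e Q'"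
  then obtain P' Q' where *: "Q' \<noteq> 0" "Fraction_Field.Fract P Q = Fraction_Field.Fract P' Q'" "g = ?e P' / ?e Q'"
    by blast
  then have "P * Q' = P' * Q" using assms by (simp add: eq_fract)
  then have "?e P * ?e Q' = ?e P' * ?e Q"
    by (metis mpoly_eval_mult[of rf_const] rf_const_hom)
  then show "g = ?e P / ?e Q"
    using * assms by (simp add: frac_eq_eq mpoly_eval_rename_eq_0_iff)
qed (use assms in auto)

lemma perm_act_hom:
  assumes "inj \<sigma>"
  shows "perm_act \<sigma> (rf_const c) = rf_const c" "perm_act \<sigma> (rf_var i) = rf_var (\<sigma> i)"
    "perm_act \<sigma> (f + g) = perm_act \<sigma> f + perm_act \<sigma> g"
    "perm_act \<sigma> (f * g) = perm_act \<sigma> f * perm_act \<sigma> g"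
proof -
  let ?e = "mpoly_eval rf_const (\<lambda>i. rf_var (\<sigma> i))"
  note e = mpoly_eval_add[of rf_const, OF rf_const_hom(1,3)]
    mpoly_eval_mult[of rf_const, OF rf_const_hom(1,3,4)]
    mpoly_eval_single[of rf_const, OF rf_const_hom(1)]
  have e1: "?e 1 = 1" using e(3)[of _ 0 1] by (simp add: rf_const_hom)
  show "perm_act \<sigma> (rf_const c) = rf_const c"
    by (subst rf_const_def) (simp add: perm_act_Fract assms e e1)
  show "perm_act \<sigma> (rf_var i) = rf_var (\<sigma> i)"
    by (subst rf_var_def) (simp add: perm_act_Fract assms e e1 rf_const_hom)
  obtain P Q P' Q' where *: "f = Fraction_Field.Fract P Q" "Q \<noteq> 0" "g = Fraction_Field.Fract P' Q'" "Q' \<noteq> 0"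
    by (meson Fract_cases)
  then show "perm_act \<sigma> (f + g) = perm_act \<sigma> f + perm_act \<sigma> g"
    "perm_act \<sigma> (f * g) = perm_act \<sigma> f * perm_act \<sigma> g"
    by (simp_all add: perm_act_Fract assms e add_frac_eq mpoly_eval_rename_eq_0_iff)
qed

definition fixed_field :: "(nat \<Rightarrow> nat) set \<Rightarrow> ratfun set \<Rightarrow> ratfun set" where
  "fixed_field G L = {f \<in> L. \<forall>\<sigma>\<in>G. perm_act \<sigma> f = f}"


section \<open>The wreath product\<close>

text \<open>
  The factor \<open>\<tau>\<close> acts on \<open>b = (b\<^sub>1, \<dots>, b\<^sub>n)\<close> by moving the entry \<open>b\<^sub>j\<close> to position \<open>\<tau> j\<close>.
\<close>

definition wreath_product :: "nat \<Rightarrow> nat \<Rightarrow> ((nat \<Rightarrow> int) \<times> (nat \<Rightarrow> nat)) monoid" where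
  "wreath_product n p =
     (let A = product_group {1..n} (\<lambda>_. integer_mod_group p)
      in \<lparr>carrier = carrier A \<times> carrier (sym_group n),
          mult = (\<lambda>(a, \<tau>) (b, \<rho>).
            (a \<otimes>\<^bsub>A\<^esub> (\<lambda>j\<in>{1..n}. b (inv_into UNIV \<tau> j)), \<tau> \<otimes>\<^bsub>sym_group n\<^esub> \<rho>)),
          one = (\<one>\<^bsub>A\<^esub>, \<one>\<^bsub>sym_group n\<^esub>)\<rparr>)"

definition wreath_sum :: "nat \<Rightarrow> nat \<Rightarrow> (nat \<Rightarrow> int) \<times> (nat \<Rightarrow> nat) \<Rightarrow> int" where
  "wreath_sum n p = (\<lambda>(a, \<tau>). finprod (integer_mod_group p) a {1..n})"

definition wreath_kernel :: "nat \<Rightarrow> nat \<Rightarrow> ((nat \<Rightarrow> int) \<times> (nat \<Rightarrow> nat)) set" where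
  "wreath_kernel n p = kernel (wreath_product n p) (integer_mod_group p) (wreath_sum n p)"

text \<open>
  An element \<open>x = (j - 1) p + r\<close> with \<open>1 \<le> r \<le> p\<close> of the \<open>j\<close>-th block has
  \<open>j - 1 = (x - 1) div p\<close> and \<open>r - 1 = (x - 1) mod p\<close>.
  \<open>block_shift n p a\<close> is the product over \<open>j\<close> of the \<open>a j\<close>-th powers of the \<open>p\<close>-cycles on the blocks.
\<close>

definition block_shift :: "nat \<Rightarrow> nat \<Rightarrow> (nat \<Rightarrow> int) \<Rightarrow> nat \<Rightarrow> nat" where
  "block_shift n p a x =
     (if x \<in> {1..n * p}
      then (x - 1) div p * p + ((x - 1) mod p + nat (a ((x - 1) div p + 1))) mod p + 1
      else x)"

definition block_perm :: "nat \<Rightarrow> nat \<Rightarrow> (nat \<Rightarrow> nat) \<Rightarrow> nat \<Rightarrow> nat" where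
  "block_perm n p \<tau> x =
     (if x \<in> {1..n * p}
      then (\<tau> ((x - 1) div p + 1) - 1) * p + (x - 1) mod p + 1
      else x)"

definition wreath_perm :: "nat \<Rightarrow> nat \<Rightarrow> (nat \<Rightarrow> int) \<times> (nat \<Rightarrow> nat) \<Rightarrow> nat \<Rightarrow> nat" where
  "wreath_perm n p = (\<lambda>(a, \<tau>). block_shift n p a \<circ> block_perm n p \<tau>)"

lemma carrier_wreath_product:
  "p > 0 \<Longrightarrow> (a, \<tau>) \<in> carrier (wreath_product n p) \<longleftrightarrow>
     a \<in> {1..n} \<rightarrow>\<^sub>E {0..<int p} \<and> \<tau> permutes {1..n}"
  by (simp add: wreath_product_def Let_def carrier_integer_mod_group sym_group_def)

lemma mult_wreath_product:
  "(a, \<tau>) \<otimes>\<^bsub>wreath_product n p\<^esub> (b, \<rho>) =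
     (\<lambda>j\<in>{1..n}. (a j + b (inv_into UNIV \<tau> j)) mod int p, \<tau> \<circ> \<rho>)"
  by (auto simp: wreath_product_def Let_def product_group_def sym_group_def fun_eq_iff)

lemma one_wreath_product: "\<one>\<^bsub>wreath_product n p\<^esub> = (\<lambda>j\<in>{1..n}. 0, id)"
  by (simp add: wreath_product_def Let_def product_group_def sym_group_def)

lemma group_wreath_product:
  assumes "p > 0"
  shows "group (wreath_product n p)"
proof (rule groupI)
  fix x y z
  assume xyz: "x \<in> carrier (wreath_product n p)" "y \<in> carrier (wreath_product n p)"
    "z \<in> carrier (wreath_product n p)"
  obtain a \<tau> b \<rho> c \<upsilon> where [simp]: "x = (a, \<tau>)" "y = (b, \<rho>)" "z = (c, \<upsilon>)"
    by (metis surj_pair)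
  have perm: "\<tau> permutes {1..n}" "\<rho> permutes {1..n}" "\<upsilon> permutes {1..n}"
    using xyz assms by (simp_all add: carrier_wreath_product)
  show "x \<otimes>\<^bsub>wreath_product n p\<^esub> y \<in> carrier (wreath_product n p)"
    using assms perm
    by (auto simp: carrier_wreath_product mult_wreath_product permutes_compose)
  have inv_in: "inv_into UNIV \<tau> j \<in> {1..n}" if "j \<in> {1..n}" for j
    using perm(1) that by (metis permutes_in_image permutes_inv)
  show "x \<otimes>\<^bsub>wreath_product n p\<^esub> y \<otimes>\<^bsub>wreath_product n p\<^esub> z =
      x \<otimes>\<^bsub>wreath_product n p\<^esub> (y \<otimes>\<^bsub>wreath_product n p\<^esub> z)"
    using inv_in perm
    by (auto simp: mult_wreath_product fun_eq_iff o_inv_distrib permutes_bij mod_simps add_ac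
        simp del: atLeastAtMost_iff)
next
  show "\<one>\<^bsub>wreath_product n p\<^esub> \<in> carrier (wreath_product n p)"
    using assms by (simp add: one_wreath_product carrier_wreath_product permutes_id)
next
  fix x assume x: "x \<in> carrier (wreath_product n p)"
  obtain a \<tau> where [simp]: "x = (a, \<tau>)" by (metis surj_pair)
  have perm: "\<tau> permutes {1..n}" and a: "a \<in> {1..n} \<rightarrow>\<^sub>E {0..<int p}"
    using x assms by (simp_all add: carrier_wreath_product)
  show "\<one>\<^bsub>wreath_product n p\<^esub> \<otimes>\<^bsub>wreath_product n p\<^esub> x = x"
    using a by (auto simp: one_wreath_product mult_wreath_product fun_eq_iff PiE_def Pi_def extensional_def)
  have "\<tau> j \<in> {1..n}" if "j \<in> {1..n}" for j
    using perm that by (simp add: permutes_in_image del: atLeastAtMost_iff)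
  then have "(\<lambda>j\<in>{1..n}. (- a (\<tau> j)) mod int p, inv_into UNIV \<tau>) \<otimes>\<^bsub>wreath_product n p\<^esub> x =
      \<one>\<^bsub>wreath_product n p\<^esub>"
    using perm by (auto simp: mult_wreath_product one_wreath_product fun_eq_iff permutes_inv_inv
        permutes_inverses mod_simps)
  moreover have "(\<lambda>j\<in>{1..n}. (- a (\<tau> j)) mod int p, inv_into UNIV \<tau>) \<in> carrier (wreath_product n p)"
    using assms perm by (auto simp: carrier_wreath_product permutes_inv)
  ultimately show "\<exists>y\<in>carrier (wreath_product n p). y \<otimes>\<^bsub>wreath_product n p\<^esub> x = \<one>\<^bsub>wreath_product n p\<^esub>"
    by blast
qed

lemma finprod_integer_mod_group:
  assumes "p > 0" "a \<in> A \<rightarrow> {0..<int p}" "finite A"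
  shows "finprod (integer_mod_group p) a A = (\<Sum>i\<in>A. a i) mod int p"
proof -
  interpret comm_group "integer_mod_group p" by simp
  show ?thesis
    using assms(3,2)
    by (induction A rule: finite_induct) (use assms(1) in \<open>auto simp: carrier_integer_mod_group mod_simps Pi_def\<close>)
qed

lemma wreath_sum_eq:
  assumes "p > 0" "(a, \<tau>) \<in> carrier (wreath_product n p)"
  shows "wreath_sum n p (a, \<tau>) = (\<Sum>i=1..n. a i) mod int p"
  using assms by (auto simp: wreath_sum_def carrier_wreath_product intro!: finprod_integer_mod_group)

lemma wreath_sum_hom:
  assumes "p > 0"
  shows "wreath_sum n p \<in> hom (wreath_product n p) (integer_mod_group p)"
proof (rule homI)
  fix x assume "x \<in> carrier (wreath_product n p)"
  with assms show "wreath_sum n p x \<in> carrier (integer_mod_group p)"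
    by (cases x) (simp add: wreath_sum_eq carrier_integer_mod_group)
next
  fix x y
  assume xy: "x \<in> carrier (wreath_product n p)" "y \<in> carrier (wreath_product n p)"
  interpret group "wreath_product n p" using assms by (rule group_wreath_product)
  obtain a \<tau> b \<rho> where [simp]: "x = (a, \<tau>)" "y = (b, \<rho>)" by (metis surj_pair)
  have "\<tau> permutes {1..n}" using xy assms by (simp add: carrier_wreath_product)
  then have "(\<Sum>i=1..n. b (inv_into UNIV \<tau> i)) = (\<Sum>i=1..n. b i)"
    using sum.permute[OF permutes_inv, of \<tau> "{1..n}" b] by (simp add: o_def)
  moreover have "x \<otimes>\<^bsub>wreath_product n p\<^esub> y \<in> carrier (wreath_product n p)" using xy by simp
  ultimately show "wreath_sum n p (x \<otimes>\<^bsub>wreath_product n p\<^esub> y) =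
      wreath_sum n p x \<otimes>\<^bsub>integer_mod_group p\<^esub> wreath_sum n p y"
    using xy assms
    by (simp add: mult_wreath_product wreath_sum_eq mod_simps sum.distrib)
qed

lemma block_elem:
  fixes j p r :: nat
  assumes "j \<in> {1..n}" "r < p"
  shows "(j - 1) * p + r + 1 \<in> {1..n * p}" "((j - 1) * p + r) div p = j - 1"
    "((j - 1) * p + r) mod p = r"
proof -
  have "(j - 1) * p + r + 1 \<le> (j - 1) * p + p" using assms by simp
  also have "\<dots> = j * p" using assms by (cases j) auto
  also have "\<dots> \<le> n * p" using assms by simp
  finally show "(j - 1) * p + r + 1 \<in> {1..n * p}" by simp
qed (use assms in auto)

lemma block_elem_cases:
  fixes x n p :: nat
  assumes "x \<in> {1..n * p}"
  obtains j r where "j \<in> {1..n}" "r < p" "x = (j - 1) * p + r + 1"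
proof
  have "p > 0" using assms by (cases p) auto
  show "(x - 1) div p + 1 \<in> {1..n}" using assms \<open>p > 0\<close>
    by (auto simp: Suc_le_eq div_less_iff_less_mult)
  show "(x - 1) mod p < p" using \<open>p > 0\<close> by simp
  show "x = ((x - 1) div p + 1 - 1) * p + (x - 1) mod p + 1" using assms by simp
qed

lemma block_shift_generator:
  assumes "p > 1" "j \<in> {1..n}"
  shows "block_shift n p (\<lambda>i\<in>{1..n}. if i = j then 1 else 0) x =
     (if x \<in> {(j - 1) * p + 1..<j * p} then x + 1 else if x = j * p then (j - 1) * p + 1 else x)"
proof (cases "x \<in> {1..n * p}")
  case True
  then obtain k r where k: "k \<in> {1..n}" "r < p" "x = (k - 1) * p + r + 1"
    by (rule block_elem_cases)
  note b = block_elem[OF k(1,2)]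
  have *: "block_shift n p (\<lambda>i\<in>{1..n}. if i = j then 1 else 0) x =
     (k - 1) * p + (r + (if k = j then 1 else 0)) mod p + 1"
    using k(1,2) b(1) by (auto simp: block_shift_def k(3) b(2,3))
  have jp: "j * p = (j - 1) * p + p" using assms by (cases j) auto
  have "x \<notin> {(j - 1) * p + 1..j * p}" if "k \<noteq> j"
  proof
    assume "x \<in> {(j - 1) * p + 1..j * p}"
    then have "(j - 1) * p \<le> x - 1" "x - 1 < (j - 1) * p + p" using jp k(3) by auto
    then have "(x - 1) div p = j - 1" by (intro div_nat_eqI) (auto simp: mult.commute)
    moreover have "(x - 1) div p = k - 1" using b(2) k(3) by simp
    ultimately show False using that k(1) assms(2) by auto
  qed
  with * k jp show ?thesis
    by (cases "k = j"; cases "r + 1 = p") auto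
next
  case False
  have "j * p \<le> n * p" "j * p \<ge> 1" using assms by simp_all
  with False have "x \<notin> {(j - 1) * p + 1..<j * p}" "x \<noteq> j * p"
    unfolding atLeastAtMost_iff atLeastLessThan_iff by linarith+
  with False show ?thesis by (simp only: block_shift_def if_False)
qed

lemma wreath_perm_block:
  assumes "(a, \<tau>) \<in> carrier (wreath_product n p)" "j \<in> {1..n}" "r < p"
  shows "wreath_perm n p (a, \<tau>) ((j - 1) * p + r + 1) =
     (\<tau> j - 1) * p + (r + nat (a (\<tau> j))) mod p + 1"
proof -
  have "\<tau> permutes {1..n}" using assms by (simp add: carrier_wreath_product)
  then have t: "\<tau> j \<in> {1..n}" using assms by (simp add: permutes_in_image del: atLeastAtMost_iff)
  show ?thesis
    using block_elem[OF assms(2,3)] block_elem[OF t assms(3)] t assms(2)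
    by (simp add: wreath_perm_def block_perm_def block_shift_def)
qed

lemma wreath_perm_mon:
  assumes "p > 0"
  shows "wreath_perm n p \<in> mon (wreath_product n p) (sym_group (n * p))"
proof -
  let ?G = "wreath_product n p"
  interpret group ?G using assms by (rule group_wreath_product)
  have out: "wreath_perm n p g x = x" if "x \<notin> {1..n * p}" for g x
    using that by (cases g) (auto simp: wreath_perm_def block_perm_def block_shift_def)
  have mult: "wreath_perm n p (x \<otimes>\<^bsub>?G\<^esub> y) = wreath_perm n p x \<circ> wreath_perm n p y"
    if xy: "x \<in> carrier ?G" "y \<in> carrier ?G" for x y
  proof
    fix z
    obtain a \<tau> b \<rho> where [simp]: "x = (a, \<tau>)" "y = (b, \<rho>)" by (metis surj_pair)
    have perm: "\<tau> permutes {1..n}" "\<rho> permutes {1..n}"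
      and ab: "a \<in> {1..n} \<rightarrow>\<^sub>E {0..<int p}" "b \<in> {1..n} \<rightarrow>\<^sub>E {0..<int p}"
      using xy assms by (simp_all add: carrier_wreath_product)
    show "wreath_perm n p (x \<otimes>\<^bsub>?G\<^esub> y) z = (wreath_perm n p x \<circ> wreath_perm n p y) z"
    proof (cases "z \<in> {1..n * p}")
      case True
      then obtain j r where z: "j \<in> {1..n}" "r < p" "z = (j - 1) * p + r + 1"
        by (rule block_elem_cases)
      have r: "\<rho> j \<in> {1..n}" using perm z by (simp add: permutes_in_image del: atLeastAtMost_iff)
      have t: "\<tau> (\<rho> j) \<in> {1..n}" using perm r by (simp add: permutes_in_image del: atLeastAtMost_iff)
      have xy': "(\<lambda>j\<in>{1..n}. (a j + b (inv_into UNIV \<tau> j)) mod int p, \<tau> \<circ> \<rho>) \<in> carrier ?G"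
        using m_closed[OF xy] by (simp add: mult_wreath_product)
      have "a (\<tau> (\<rho> j)) \<ge> 0" "b (\<rho> j) \<ge> 0" using ab r t by (auto simp: PiE_def Pi_def)
      then have "(r + nat ((a (\<tau> (\<rho> j)) + b (\<rho> j)) mod int p)) mod p =
          ((r + nat (b (\<rho> j))) mod p + nat (a (\<tau> (\<rho> j)))) mod p"
        by (simp add: nat_mod_distrib nat_add_distrib mod_simps add_ac)
      then have *: "wreath_perm n p (x \<otimes>\<^bsub>?G\<^esub> y) z =
          (\<tau> (\<rho> j) - 1) * p + ((r + nat (b (\<rho> j))) mod p + nat (a (\<tau> (\<rho> j)))) mod p + 1"
        using wreath_perm_block[OF xy' z(1,2)] t perm(1)
        by (simp add: mult_wreath_product z(3) permutes_inverses)
      have "(r + nat (b (\<rho> j))) mod p < p" using assms by simp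
      from wreath_perm_block[OF xy(1)[simplified] r this]
      have "(wreath_perm n p x \<circ> wreath_perm n p y) z =
          (\<tau> (\<rho> j) - 1) * p + ((r + nat (b (\<rho> j))) mod p + nat (a (\<tau> (\<rho> j)))) mod p + 1"
        by (simp only: z(3) o_apply \<open>x = (a, \<tau>)\<close> \<open>y = (b, \<rho>)\<close>
            wreath_perm_block[OF xy(2)[simplified] z(1,2)])
      with * show ?thesis by metis
    qed (simp add: out)
  qed
  have one: "wreath_perm n p \<one>\<^bsub>?G\<^esub> = id"
  proof
    fix z
    show "wreath_perm n p \<one>\<^bsub>?G\<^esub> z = id z"
    proof (cases "z \<in> {1..n * p}")
      case True
      then obtain j r where z: "j \<in> {1..n}" "r < p" "z = (j - 1) * p + r + 1"
        by (rule block_elem_cases)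
      then show ?thesis
        using wreath_perm_block[of "\<lambda>j\<in>{1..n}. 0" id n p j r] one_closed
        by (simp add: one_wreath_product del: add_Suc_right)
    qed (simp add: out)
  qed
  have perm: "wreath_perm n p x permutes {1..n * p}" if x: "x \<in> carrier ?G" for x
  proof -
    have "bij (wreath_perm n p x)"
      using mult[OF x inv_closed[OF x]] mult[OF inv_closed[OF x] x] x one
      by (intro o_bij[of "wreath_perm n p (inv\<^bsub>?G\<^esub> x)"]) simp_all
    then show ?thesis using out by (auto simp: permutes_def bij_iff)
  qed
  have "wreath_perm n p \<in> hom ?G (sym_group (n * p))"
    by (rule homI) (use perm mult in \<open>auto simp: sym_group_def\<close>)
  moreover have "inj_on (wreath_perm n p) (carrier ?G)"
  proof (rule inj_onI)
    fix x y assume xy: "x \<in> carrier ?G" "y \<in> carrier ?G" "wreath_perm n p x = wreath_perm n p y"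
    obtain a \<tau> b \<rho> where [simp]: "x = (a, \<tau>)" "y = (b, \<rho>)" by (metis surj_pair)
    have perm: "\<tau> permutes {1..n}" "\<rho> permutes {1..n}"
      and ab: "a \<in> {1..n} \<rightarrow>\<^sub>E {0..<int p}" "b \<in> {1..n} \<rightarrow>\<^sub>E {0..<int p}"
      using xy assms by (simp_all add: carrier_wreath_product)
    have *: "\<tau> j = \<rho> j \<and> a (\<tau> j) = b (\<tau> j)" if j: "j \<in> {1..n}" for j
    proof -
      have t: "\<tau> j \<in> {1..n}" and r: "\<rho> j \<in> {1..n}"
        using perm j by (simp_all add: permutes_in_image del: atLeastAtMost_iff)
      then have bd: "a (\<tau> j) \<ge> 0" "b (\<rho> j) \<ge> 0" "a (\<tau> j) < int p" "b (\<rho> j) < int p"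
        using ab by (auto simp: PiE_def Pi_def)
      then have lt: "nat (a (\<tau> j)) < p" "nat (b (\<rho> j)) < p" by linarith+
      have "(\<tau> j - 1) * p + nat (a (\<tau> j)) = (\<rho> j - 1) * p + nat (b (\<rho> j))"
        using xy(3) wreath_perm_block[OF xy(1)[simplified] j assms] 
          wreath_perm_block[OF xy(2)[simplified] j assms] lt by simp
      then have "\<tau> j - 1 = \<rho> j - 1" "nat (a (\<tau> j)) = nat (b (\<rho> j))"
        using block_elem(2,3)[OF t lt(1)] block_elem(2,3)[OF r lt(2)] by metis+
      moreover from this(1) have "\<tau> j = \<rho> j" using t r by auto
      ultimately show ?thesis using bd by simp
    qed
    have "\<tau> = \<rho>" using * perm by (metis ext permutes_not_in)
    moreover have "a = b"
    proof (rule PiE_ext[OF ab])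
      fix i assume i: "i \<in> {1..n}"
      then have "inv_into UNIV \<tau> i \<in> {1..n}" using perm(1) by (metis permutes_in_image permutes_inv)
      from *[OF this] show "a i = b i" using perm(1) by (simp add: permutes_inverses)
    qed
    ultimately show "x = y" by simp
  qed
  ultimately show ?thesis by (simp add: mon_def)
qed

end

theory Submission
  imports Defs "HOL-Computational_Algebra.Fundamental_Theorem_Algebra"
begin

text \<open>
  Let \<open>\<omega>\<close> be a primitive \<open>p\<close>-th root of unity. The discrete Fourier transform of the \<open>j\<close>-th block of
  variables gives \<open>Y j k\<close>, on which the cyclic shift of that block acts by the scalar \<open>\<omega>\<^sup>k\<close>. Put
  \<open>T j = Y j 1\<close>, \<open>U j = T j ^ p\<close> and \<open>Z j k = Y j k / T j ^ k\<close>; the kernel then permutes the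
  \<open>U j\<close> and the \<open>Z j k\<close> (for fixed \<open>k\<close>) and fixes \<open>W = \<Prod>\<^sub>j T j\<close>. The fixed field is generated by the
  \<open>n p\<close> invariants consisting of \<open>W\<close>, the elementary symmetric functions of the \<open>U j\<close> except the last
  one (which is \<open>W ^ p\<close>), and the moments \<open>M k i = \<Sum>\<^sub>j Z j k * U j ^ i\<close> with \<open>k \<noteq> 1\<close> and \<open>i < n\<close>.

  Generation: let \<open>F\<close> be the field generated by these invariants. Inverting the Vandermonde matrix
  of the \<open>U j\<close> shows that the whole function field is the fraction field of \<open>R = F[T 1, \<dots>, T n]\<close>, so it
  suffices that the trace over the kernel maps monomials in the \<open>T j\<close> into \<open>F\<close>. The trace of
  a monomial vanishes unless all exponents are congruent modulo \<open>p\<close>, and otherwise it is a power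
  of \<open>W\<close> times a symmetric function of the \<open>U j\<close>.

  Independence: by the fundamental theorem of algebra and the invertibility of the Vandermonde and
  Fourier matrices, the values of the generators at complex points are Zariski dense.
\<close>

section \<open>Subrings and compatible relations\<close>

text \<open>Homomorphisms are treated as relations so that the same transport lemmas serve for the
  action of a permutation, for evaluation at a point where poles may occur and, with the second
  argument ignored, for membership in a subring.\<close>

locale ring_rel =
  fixes rel :: "'a::comm_ring_1 \<Rightarrow> 'b::comm_ring_1 \<Rightarrow> bool"
  assumes zero: "rel 0 0" and one: "rel 1 1"
    and add: "rel x y \<Longrightarrow> rel x' y' \<Longrightarrow> rel (x + x') (y + y')"
    and uminus: "rel x y \<Longrightarrow> rel (- x) (- y)"
    and mult: "rel x y \<Longrightarrow> rel x' y' \<Longrightarrow> rel (x * x') (y * y')"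
begin

lemma diff: "rel x y \<Longrightarrow> rel x' y' \<Longrightarrow> rel (x - x') (y - y')"
  using add[OF _ uminus, of x y x' y'] by simp

lemma sum: "(\<And>i. i \<in> A \<Longrightarrow> rel (f i) (g i)) \<Longrightarrow> rel (sum f A) (sum g A)"
  by (induction A rule: infinite_finite_induct) (auto intro: zero add)

lemma prod: "(\<And>i. i \<in> A \<Longrightarrow> rel (f i) (g i)) \<Longrightarrow> rel (prod f A) (prod g A)"
  by (induction A rule: infinite_finite_induct) (auto intro: one mult)

lemma power: "rel x y \<Longrightarrow> rel (x ^ k) (y ^ k)"
  by (induction k) (auto intro: one mult)

lemma mpoly_eval:
  assumes "\<And>c. rel (\<iota> c) (\<iota>' c)"
    and "\<And>m i. m \<in> Poly_Mapping.keys P \<Longrightarrow> i \<in> Poly_Mapping.keys m \<Longrightarrow> rel (v i) (v' i)"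
  shows "rel (mpoly_eval \<iota> v P) (mpoly_eval \<iota>' v' P)"
  unfolding mpoly_eval_def by (intro sum mult prod power assms)

end

locale subring_of =
  fixes S :: "'a::comm_ring_1 set"
  assumes one: "1 \<in> S"
    and uminus: "x \<in> S \<Longrightarrow> - x \<in> S"
    and add: "x \<in> S \<Longrightarrow> y \<in> S \<Longrightarrow> x + y \<in> S"
    and mult: "x \<in> S \<Longrightarrow> y \<in> S \<Longrightarrow> x * y \<in> S"
begin

lemma zero: "0 \<in> S"
  using add[OF one uminus[OF one]] by simp

lemma diff: "x \<in> S \<Longrightarrow> y \<in> S \<Longrightarrow> x - y \<in> S"
  using add[OF _ uminus, of x y] by simp

lemma sum: "(\<And>i. i \<in> A \<Longrightarrow> f i \<in> S) \<Longrightarrow> sum f A \<in> S"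
  by (induction A rule: infinite_finite_induct) (auto intro: zero add)

lemma prod: "(\<And>i. i \<in> A \<Longrightarrow> f i \<in> S) \<Longrightarrow> prod f A \<in> S"
  by (induction A rule: infinite_finite_induct) (auto intro: one mult)

lemma power: "x \<in> S \<Longrightarrow> x ^ k \<in> S"
  by (induction k) (auto intro: one mult)

lemma of_nat: "of_nat k \<in> S"
  by (induction k) (auto intro: zero one add)

end

locale subfield_of = subring_of S for S :: "'a::field set" +
  assumes inverse: "x \<in> S \<Longrightarrow> inverse x \<in> S"
begin

lemma divide: "x \<in> S \<Longrightarrow> y \<in> S \<Longrightarrow> x / y \<in> S"
  by (simp add: divide_inverse mult inverse)

end

lemma subfield_of_adjoin: "subfield_of (adjoin \<iota> S)"
  by unfold_locales (simp_all add: adjoin_eq_Inter)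

lemma adjoin_const: "\<iota> c \<in> adjoin \<iota> S" and adjoin_gen: "x \<in> S \<Longrightarrow> x \<in> adjoin \<iota> S"
  by (auto simp: adjoin_eq_Inter)

lemma adjoin_subset:
  assumes "subfield_of F" "range \<iota> \<subseteq> F" "S \<subseteq> F"
  shows "adjoin \<iota> S \<subseteq> F"
proof -
  interpret subfield_of F by fact
  show ?thesis
    unfolding adjoin_eq_Inter
    by (rule Inter_lower) (use assms(2,3) in \<open>auto simp: one uminus add mult inverse\<close>)
qed

section \<open>Polynomials with given roots and symmetric sums\<close>

text \<open>Its coefficients are, up to sign, the elementary symmetric functions of the
  \<open>u j\<close>.\<close>

definition root_poly :: "('i \<Rightarrow> 'a::comm_ring_1) \<Rightarrow> 'i set \<Rightarrow> 'a poly" where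
  "root_poly u J = (\<Prod>j\<in>J. [:- u j, 1:])"

lemma coeff_linear_mult:
  fixes q :: "'a::comm_ring_1 poly"
  shows "poly.coeff ([:- c, 1:] * q) k = (if k = 0 then 0 else poly.coeff q (k - 1)) - c * poly.coeff q k"
  by (cases k) simp_all

text \<open>The coefficients are integral polynomial expressions in the roots; adjoining one root at
  a time changes them by \<open>coeff_linear_mult\<close>.\<close>

lemma (in ring_rel) coeff_root_poly:
  assumes "\<And>j. j \<in> J \<Longrightarrow> rel (u j) (v j)"
  shows "rel (poly.coeff (root_poly u J) k) (poly.coeff (root_poly v J) k)"
  using assms
proof (induction J arbitrary: k rule: infinite_finite_induct)
  case (insert i J)
  then have ih: "rel (poly.coeff (root_poly u J) k) (poly.coeff (root_poly v J) k)" for k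
    by simp
  have "root_poly u (insert i J) = [:- u i, 1:] * root_poly u J"
    "root_poly v (insert i J) = [:- v i, 1:] * root_poly v J"
    using insert.hyps by (simp_all add: root_poly_def)
  then show ?case
    using insert.prems by (auto simp only: coeff_linear_mult split: if_split intro!: diff mult ih zero)
qed (auto simp: root_poly_def coeff_1 one zero)

lemma
  fixes u :: "'i \<Rightarrow> 'a::idom"
  shows degree_root_poly: "degree (root_poly u J) = card J"
    and lead_coeff_root_poly: "poly.coeff (root_poly u J) (card J) = 1"
proof -
  show *: "degree (root_poly u J) = card J"
    unfolding root_poly_def by (subst degree_prod_eq_sum_degree) simp_all
  show "poly.coeff (root_poly u J) (card J) = 1"
    unfolding *[symmetric] by (simp add: root_poly_def lead_coeff_prod)
qed

lemma poly_root_poly: "poly (root_poly u J) x = (\<Prod>j\<in>J. x - u j)"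
  by (simp add: root_poly_def poly_prod)

lemma coeff_root_poly_0: "poly.coeff (root_poly u J) 0 = (-1) ^ card J * (\<Prod>j\<in>J. u j)"
proof -
  have "poly.coeff (root_poly u J) 0 = poly (root_poly u J) 0"
    by (simp add: poly_0_coeff_0)
  also have "\<dots> = (\<Prod>j\<in>J. (-1) * u j)"
    by (simp add: poly_root_poly)
  also have "\<dots> = (-1) ^ card J * (\<Prod>j\<in>J. u j)"
    by (subst prod.distrib) simp
  finally show ?thesis .
qed

section \<open>Division by a linear factor, Newton's identities and power sums\<close>

text \<open>Synthetic division by \<open>X - u j\<close>: the quotient coefficients satisfy
  \<open>b_i = a_(i+1) + u j * b_(i+1)\<close>, and the recursion is unrolled past the degree. They
  are thus expressed through \<open>u j\<close> and the symmetric coefficients alone.\<close>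

lemma coeff_root_poly_remove:
  fixes u :: "'i \<Rightarrow> 'a::idom"
  assumes "finite J" "j \<in> J"
  shows "poly.coeff (root_poly u (J - {j})) i =
    (\<Sum>l<card J - i. poly.coeff (root_poly u J) (i + 1 + l) * u j ^ l)"
proof -
  let ?A = "root_poly u J" and ?B = "root_poly u (J - {j})"
  have "?A = [:- u j, 1:] * ?B"
    using assms by (simp add: root_poly_def prod.remove)
  then have step: "poly.coeff ?B i = poly.coeff ?A (Suc i) + u j * poly.coeff ?B (Suc i)" for i
    by (simp add: coeff_linear_mult)
  have *: "poly.coeff ?B i =
      (\<Sum>l<d. poly.coeff ?A (i + 1 + l) * u j ^ l) + u j ^ d * poly.coeff ?B (i + d)" for d
  proof (induction d)
    case (Suc d)
    have "poly.coeff ?B (i + d) = poly.coeff ?A (i + 1 + d) + u j * poly.coeff ?B (i + Suc d)"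
      using step[of "i + d"] by simp
    with Suc show ?case by (simp add: algebra_simps)
  qed simp
  have "card J > 0" using assms by (auto simp: card_gt_0_iff)
  \<comment> \<open>The quotient has degree \<open>card J - 1\<close>, which is below this index;
    truncated subtraction also covers \<open>i > card J\<close>.\<close>
  then have "poly.coeff ?B (i + (card J - i)) = 0"
    using assms by (intro coeff_eq_0) (simp add: degree_root_poly card_Diff_singleton)
  with *[of "card J - i"] show ?thesis by simp
qed

text \<open>Newton's identities: compare coefficients in \<open>A' = \<Sum>\<^sub>j A / (X - u\<^sub>j)\<close>.\<close>

lemma newton_identity:
  fixes u :: "'i \<Rightarrow> 'a::idom"
  assumes "finite J"
  shows "of_nat (Suc i) * poly.coeff (root_poly u J) (Suc i) =
    (\<Sum>l<card J - i. poly.coeff (root_poly u J) (i + 1 + l) * (\<Sum>j\<in>J. u j ^ l))"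
proof -
  have "pderiv (root_poly u J) = (\<Sum>j\<in>J. root_poly u (J - {j}))"
    by (simp add: root_poly_def pderiv_prod pderiv_pCons)
  then have "of_nat (Suc i) * poly.coeff (root_poly u J) (Suc i) =
      (\<Sum>j\<in>J. poly.coeff (root_poly u (J - {j})) i)"
    by (metis coeff_pderiv coeff_sum)
  also have "\<dots> = (\<Sum>j\<in>J. \<Sum>l<card J - i. poly.coeff (root_poly u J) (i + 1 + l) * u j ^ l)"
    by (rule sum.cong) (simp_all add: coeff_root_poly_remove assms)
  also have "\<dots> = (\<Sum>l<card J - i. poly.coeff (root_poly u J) (i + 1 + l) * (\<Sum>j\<in>J. u j ^ l))"
    by (subst sum.swap) (simp add: sum_distrib_left)
  finally show ?thesis .
qed

text \<open>Strong induction on \<open>k\<close>. Below \<open>card J\<close>, Newton's identity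
  contains the new power sum with the leading coefficient 1; from \<open>card J\<close> on, the fact
  that every \<open>u j\<close> is a root reduces it to lower ones. Neither case divides, so a
  subring suffices.\<close>

lemma power_sum_mem:
  fixes u :: "'i \<Rightarrow> 'a::idom"
  assumes "subring_of S" "finite J" and coeff: "\<And>i. poly.coeff (root_poly u J) i \<in> S"
  shows "(\<Sum>j\<in>J. u j ^ k) \<in> S"
proof (induction k rule: less_induct)
  case (less k)
  interpret subring_of S by fact
  let ?A = "root_poly u J" and ?n = "card J" and ?p = "\<lambda>k. \<Sum>j\<in>J. u j ^ k"
  show ?case
  proof (cases "k < ?n")
    case True
    define i where "i = ?n - 1 - k"
    have i: "?n - i = Suc k" "i + 1 + k = ?n" using True by (auto simp: i_def)
    have "of_nat (Suc i) * poly.coeff ?A (Suc i) =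
        (\<Sum>l<k. poly.coeff ?A (i + 1 + l) * ?p l) + ?p k"
      using newton_identity[OF assms(2), of i u] i lead_coeff_root_poly[of u J] by simp
    then have "?p k = of_nat (Suc i) * poly.coeff ?A (Suc i) - (\<Sum>l<k. poly.coeff ?A (i + 1 + l) * ?p l)"
      by simp
    also have "\<dots> \<in> S"
      by (intro diff mult sum of_nat coeff less) simp_all
    finally show ?thesis .
  next
    case False
    define d where "d = k - ?n"
    have k: "k = d + ?n" using False by (simp add: d_def)
    have "0 = (\<Sum>j\<in>J. u j ^ d * poly ?A (u j))"
      using assms(2) by (intro sum.neutral[symmetric]) (auto simp: poly_root_poly)
    also have "\<dots> = (\<Sum>j\<in>J. \<Sum>i\<le>?n. poly.coeff ?A i * u j ^ (d + i))"
      by (simp add: poly_altdef degree_root_poly sum_distrib_left power_add mult_ac)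
    also have "\<dots> = (\<Sum>i\<le>?n. poly.coeff ?A i * ?p (d + i))"
      by (subst sum.swap) (simp add: sum_distrib_left)
    also have "\<dots> = (\<Sum>i<?n. poly.coeff ?A i * ?p (d + i)) + ?p k"
      by (simp add: k lead_coeff_root_poly flip: lessThan_Suc_atMost)
    finally have "?p k = - (\<Sum>i<?n. poly.coeff ?A i * ?p (d + i))"
      by (simp add: eq_neg_iff_add_eq_0 add.commute)
    also have "\<dots> \<in> S"
      by (intro uminus sum mult coeff less) (simp add: k)
    finally show ?thesis .
  qed
qed

section \<open>Sums of monomials over injective maps and over permutations\<close>

text \<open>Induction on \<open>A\<close>. With \<open>\<phi>\<close> fixed on \<open>A\<close>, the
  admissible values at a new index \<open>b\<close> contribute the full power sum minus the
  collisions with some \<open>\<phi> i\<close>, and a collision merely adds the exponent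
  \<open>q b\<close> to \<open>q i\<close>; hence \<open>q\<close> varies in the induction.
  Injective maps, unlike permutations, let \<open>A\<close> grow while \<open>J\<close> stays
  fixed.\<close>

lemma (in subring_of) injective_sum_mem:
  fixes A :: "'c set"
  assumes "finite J" and power_sum: "\<And>k. (\<Sum>j\<in>J. u j ^ k) \<in> S" and "finite A"
  shows "(\<Sum>\<phi> | \<phi> \<in> A \<rightarrow>\<^sub>E J \<and> inj_on \<phi> A. \<Prod>j\<in>A. u (\<phi> j) ^ q j) \<in> S"
  using \<open>finite A\<close>
proof (induction A arbitrary: q rule: finite_induct)
  case empty
  have "{\<phi>. \<phi> \<in> {} \<rightarrow>\<^sub>E J \<and> inj_on \<phi> {}} = {\<lambda>_. undefined}" by auto
  then show ?case by (simp add: one)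
next
  case (insert b A)
  define I where "I B = {\<phi>. \<phi> \<in> B \<rightarrow>\<^sub>E J \<and> inj_on \<phi> B}" for B :: "'c set"
  have fin: "finite (I A)"
    unfolding I_def by (rule finite_subset[OF _ finite_PiE[of A "\<lambda>_. J"]])
      (use insert.hyps assms in auto)
  \<comment> \<open>A map on \<open>insert b A\<close> is split into its restriction to
    \<open>A\<close> and its value at \<open>b\<close>; resetting \<open>b\<close> to
    \<open>undefined\<close> keeps the restriction extensional.\<close>
  have "(\<Sum>\<phi>\<in>I (insert b A). \<Prod>j\<in>insert b A. u (\<phi> j) ^ q j) =
      (\<Sum>(\<phi>, x)\<in>Sigma (I A) (\<lambda>\<phi>. J - \<phi> ` A). (\<Prod>j\<in>A. u (\<phi> j) ^ q j) * u x ^ q b)"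
  proof (rule sum.reindex_bij_witness[where i = "\<lambda>(\<phi>, x). \<phi>(b := x)" and
        j = "\<lambda>\<phi>. (\<phi>(b := undefined), \<phi> b)"], goal_cases)
    case (2 \<phi>)
    then have *: "\<phi> \<in> insert b A \<rightarrow>\<^sub>E J" "inj_on \<phi> (insert b A)" by (auto simp: I_def)
    have "\<phi>(b := undefined) \<in> A \<rightarrow>\<^sub>E J"
      using *(1) insert.hyps by (auto simp: PiE_def extensional_def Pi_def)
    moreover have "inj_on (\<phi>(b := undefined)) A"
      using *(2) insert.hyps by (auto simp: inj_on_def)
    moreover have "\<phi>(b := undefined) ` A = \<phi> ` A" using insert.hyps by (auto simp: image_def)
    moreover have "\<phi> b \<in> J" using *(1) by auto
    moreover have "\<phi> b \<notin> \<phi> ` A" using *(2) insert.hyps by (auto simp: inj_on_def)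
    ultimately show ?case by (simp add: I_def)
  next
    case (3 \<phi>x)
    obtain \<phi> x where [simp]: "\<phi>x = (\<phi>, x)" by (cases \<phi>x)
    have "\<phi> b = undefined" using 3 insert.hyps by (auto simp: I_def PiE_def extensional_def)
    then show ?case by (auto simp: fun_eq_iff)
  next
    case (4 \<phi>x)
    obtain \<phi> x where [simp]: "\<phi>x = (\<phi>, x)" by (cases \<phi>x)
    have *: "\<phi> \<in> A \<rightarrow>\<^sub>E J" "inj_on \<phi> A" "x \<in> J" "x \<notin> \<phi> ` A" using 4 by (auto simp: I_def)
    have "\<phi>(b := x) \<in> insert b A \<rightarrow>\<^sub>E J" using * by (auto simp: PiE_def extensional_def Pi_def)
    moreover have "inj_on (\<phi>(b := x)) (insert b A)"
      using * insert.hyps by (auto simp: inj_on_def image_iff)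
    ultimately show ?case by (simp add: I_def)
  next
    case (5 \<phi>)
    have "(\<Prod>j\<in>A. u ((\<phi>(b := undefined)) j) ^ q j) = (\<Prod>j\<in>A. u (\<phi> j) ^ q j)"
      by (rule prod.cong) (use insert.hyps in auto)
    then show ?case using insert.hyps by (simp add: mult.commute)
  qed auto
  also have "\<dots> = (\<Sum>\<phi>\<in>I A. \<Sum>x\<in>J - \<phi> ` A. (\<Prod>j\<in>A. u (\<phi> j) ^ q j) * u x ^ q b)"
    using fin assms(1) by (simp add: sum.Sigma)
  also have "\<dots> = (\<Sum>\<phi>\<in>I A. (\<Prod>j\<in>A. u (\<phi> j) ^ q j) * (\<Sum>j\<in>J. u j ^ q b) -
      (\<Sum>i\<in>A. \<Prod>j\<in>A. u (\<phi> j) ^ (q(i := q i + q b)) j))"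
  proof (rule sum.cong[OF refl])
    fix \<phi> assume "\<phi> \<in> I A"
    then have *: "\<phi> ` A \<subseteq> J" "inj_on \<phi> A" by (auto simp: I_def)
    have "(\<Sum>x\<in>J - \<phi> ` A. u x ^ q b) = (\<Sum>j\<in>J. u j ^ q b) - (\<Sum>i\<in>A. u (\<phi> i) ^ q b)"
      using * assms(1) by (simp add: sum_diff sum.reindex)
    moreover have "(\<Prod>j\<in>A. u (\<phi> j) ^ (q(i := q i + q b)) j) =
        (\<Prod>j\<in>A. u (\<phi> j) ^ q j) * u (\<phi> i) ^ q b" if "i \<in> A" for i
      using insert.hyps that by (simp add: prod.remove[where x = i] power_add mult_ac)
    ultimately show "(\<Sum>x\<in>J - \<phi> ` A. (\<Prod>j\<in>A. u (\<phi> j) ^ q j) * u x ^ q b) =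
        (\<Prod>j\<in>A. u (\<phi> j) ^ q j) * (\<Sum>j\<in>J. u j ^ q b) -
        (\<Sum>i\<in>A. \<Prod>j\<in>A. u (\<phi> j) ^ (q(i := q i + q b)) j)"
      by (simp add: right_diff_distrib flip: sum_distrib_left)
  qed
  also have "\<dots> = (\<Sum>\<phi>\<in>I A. \<Prod>j\<in>A. u (\<phi> j) ^ q j) * (\<Sum>j\<in>J. u j ^ q b) -
      (\<Sum>i\<in>A. \<Sum>\<phi>\<in>I A. \<Prod>j\<in>A. u (\<phi> j) ^ (q(i := q i + q b)) j)"
    by (simp add: sum_subtractf sum_distrib_right sum.swap[of _ A])
  also have "\<dots> \<in> S"
    by (intro diff mult sum[of A] power_sum insert.IH[folded I_def])
  finally show ?case by (simp add: I_def)
qed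

text \<open>An injective self-map of a finite set is a permutation; the two encodings differ only
  outside \<open>J\<close>, where one is \<open>undefined\<close> and the other the
  identity.\<close>

lemma (in subring_of) permutation_sum_mem:
  assumes "finite J" and "\<And>k. (\<Sum>j\<in>J. u j ^ k) \<in> S"
  shows "(\<Sum>\<tau> | \<tau> permutes J. \<Prod>j\<in>J. u (\<tau> j) ^ q j) \<in> S"
proof -
  have "(\<Sum>\<tau> | \<tau> permutes J. \<Prod>j\<in>J. u (\<tau> j) ^ q j) =
      (\<Sum>\<phi> | \<phi> \<in> J \<rightarrow>\<^sub>E J \<and> inj_on \<phi> J. \<Prod>j\<in>J. u (\<phi> j) ^ q j)"
  proof (rule sum.reindex_bij_witness[where j = "\<lambda>\<tau>. restrict \<tau> J" and
        i = "\<lambda>\<phi> x. if x \<in> J then \<phi> x else x"], goal_cases)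
    case (1 \<tau>)
    then show ?case by (auto simp: fun_eq_iff permutes_not_in)
  next
    case (2 \<tau>)
    then show ?case
      by (auto simp: permutes_in_image inj_on_def dest: permutes_inj[THEN injD])
  next
    case (3 \<phi>)
    then show ?case by (auto simp: fun_eq_iff PiE_def extensional_def)
  next
    case (4 \<phi>)
    then have "inj_on \<phi> J" "\<phi> ` J \<subseteq> J" by auto
    then have "bij_betw \<phi> J J"
      using endo_inj_surj[OF assms(1), of \<phi>] by (simp add: bij_betw_def)
    then have "bij_betw (\<lambda>x. if x \<in> J then \<phi> x else x) J J"
      by (subst bij_betw_cong[where g = \<phi>]) auto
    then show ?case by (auto intro!: bij_imp_permutes)
  qed auto
  then show ?thesis using injective_sum_mem[OF assms assms(1)] by simp
qed

section \<open>Invariant fractions\<close>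

text \<open>
  With \<open>r\<close> the product of the nontrivial conjugates of \<open>b\<close>, an invariant \<open>a / b\<close> is the quotient
  of the traces of \<open>a r\<close> and \<open>b r\<close>, the latter being a multiple of the norm of \<open>b\<close>.
\<close>

lemma invariant_fraction_mem:
  fixes act :: "'g \<Rightarrow> 'a::field \<Rightarrow> 'a" and G :: "('g, 'm) monoid_scheme"
  assumes "group G" "finite (carrier G)" "of_nat (card (carrier G)) \<noteq> (0::'a)"
    and act_one: "\<And>x. act \<one>\<^bsub>G\<^esub> x = x"
    and act_mult: "\<And>g h x. g \<in> carrier G \<Longrightarrow> h \<in> carrier G \<Longrightarrow> act (g \<otimes>\<^bsub>G\<^esub> h) x = act g (act h x)"
    and act_hom: "\<And>g. g \<in> carrier G \<Longrightarrow> ring_rel (\<lambda>x y. y = act g x)"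
    and "subfield_of F" "subring_of R"
    and R_act: "\<And>g x. g \<in> carrier G \<Longrightarrow> x \<in> R \<Longrightarrow> act g x \<in> R"
    and trace: "\<And>x. x \<in> R \<Longrightarrow> (\<Sum>g\<in>carrier G. act g x) \<in> F"
    and ab: "a \<in> R" "b \<in> R" "b \<noteq> 0"
    and inv: "\<And>g. g \<in> carrier G \<Longrightarrow> act g (a / b) = a / b"
  shows "a / b \<in> F"
proof -
  interpret group G by fact
  interpret F: subfield_of F by fact
  interpret R: subring_of R by fact
  define r where "r = (\<Prod>h\<in>carrier G - {\<one>\<^bsub>G\<^esub>}. act h b)"
  define N where "N = (\<Prod>h\<in>carrier G. act h b)"
  have br: "b * r = N"
    using assms(2) by (simp add: N_def r_def prod.remove[OF _ one_closed] act_one)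
  have mult: "act g (x * y) = act g x * act g y" if "g \<in> carrier G" for g x y
    using ring_rel.mult[OF act_hom[OF that]] by metis
  have act_N: "act g N = N" if g: "g \<in> carrier G" for g
  proof -
    have "act g N = (\<Prod>h\<in>carrier G. act g (act h b))"
      using ring_rel.prod[OF act_hom[OF g],
          where f = "\<lambda>h. act h b" and g = "\<lambda>h. act g (act h b)" and A = "carrier G"] by (simp add: N_def)
    also have "\<dots> = (\<Prod>h\<in>carrier G. act (g \<otimes>\<^bsub>G\<^esub> h) b)"
      using g by (simp add: act_mult)
    also have "\<dots> = N"
      unfolding N_def
    proof (rule prod.reindex_bij_betw[where h = "\<lambda>h. g \<otimes>\<^bsub>G\<^esub> h"])
      show "bij_betw (\<lambda>h. g \<otimes>\<^bsub>G\<^esub> h) (carrier G) (carrier G)"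
        by (rule bij_betwI[where g = "\<lambda>h. inv\<^bsub>G\<^esub> g \<otimes>\<^bsub>G\<^esub> h"]) (use g in \<open>auto simp flip: m_assoc\<close>)
    qed
    finally show ?thesis .
  qed
  have "act h b \<noteq> 0" if h: "h \<in> carrier G" for h
  proof
    assume "act h b = 0"
    then have "act (inv\<^bsub>G\<^esub> h) (act h b) = 0"
      using ring_rel.zero[OF act_hom[of "inv\<^bsub>G\<^esub> h"]] h by simp
    then show False using ab(3) h act_mult[of "inv\<^bsub>G\<^esub> h" h b] by (simp add: act_one)
  qed
  then have "N \<noteq> 0" using assms(2) by (simp add: N_def)
  have "r \<in> R" unfolding r_def by (intro R.prod R_act ab(2)) auto
  then have "(\<Sum>g\<in>carrier G. act g (a * r)) \<in> F" "(\<Sum>g\<in>carrier G. act g (b * r)) \<in> F"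
    using ab by (auto intro: trace R.mult)
  moreover have "(\<Sum>g\<in>carrier G. act g (b * r)) = of_nat (card (carrier G)) * N"
    by (simp add: br act_N)
  moreover have "a * r = (a / b) * N" using ab(3) br by (simp add: field_simps)
  then have "(\<Sum>g\<in>carrier G. act g (a * r)) = of_nat (card (carrier G)) * ((a / b) * N)"
    by (simp only: mult inv act_N sum_constant cong: sum.cong)
  \<comment> \<open>This is the quotient of the two traces; the group order, nonzero by assumption,
    and the norm then cancel.\<close>
  ultimately have "of_nat (card (carrier G)) * ((a / b) * N) / (of_nat (card (carrier G)) * N) \<in> F"
    by (metis F.divide)
  with \<open>N \<noteq> 0\<close> assms(3) show ?thesis by simp
qed

lemma subfield_of_fractions:
  fixes R :: "'a::field set"
  assumes "subring_of R"
  shows "subfield_of {x. \<exists>a b. a \<in> R \<and> b \<in> R \<and> b \<noteq> 0 \<and> x = a / b}" (is "subfield_of ?K")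
proof -
  interpret R: subring_of R by fact
  have KI: "a / b \<in> ?K" if "a \<in> R" "b \<in> R" "b \<noteq> 0" for a b using that by blast
  show ?thesis
  proof
    show "1 \<in> ?K" using KI[OF R.one R.one] by simp
  next
    fix x assume "x \<in> ?K"
    then obtain a b where x: "a \<in> R" "b \<in> R" "b \<noteq> 0" "x = a / b" by blast
    show "- x \<in> ?K" using KI[of "- a" b] x R.uminus by simp
    show "inverse x \<in> ?K"
      using KI[of b a] KI[OF R.zero R.one] x by (cases "a = 0") simp_all
    fix y assume "y \<in> ?K"
    then obtain c d where y: "c \<in> R" "d \<in> R" "d \<noteq> 0" "y = c / d" by blast
    show "x + y \<in> ?K"
      using KI[of "a * d + c * b" "b * d"] x y by (simp add: add_frac_eq R.add R.mult)
    show "x * y \<in> ?K" using KI[of "a * c" "b * d"] x y by (simp add: R.mult)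
  qed
qed

text \<open>For a subring \<open>F\<close> and finite \<open>J\<close> this is the ring generated
  over \<open>F\<close> by the \<open>t j\<close>. Adding one monomial at a time gives an induction
  suited to additive maps such as the trace.\<close>

inductive_set monomial_span :: "'a::comm_ring_1 set \<Rightarrow> ('j \<Rightarrow> 'a) \<Rightarrow> 'j set \<Rightarrow> 'a set"
  for F :: "'a set" and t :: "'j \<Rightarrow> 'a" and J :: "'j set" where
  zero: "0 \<in> monomial_span F t J"
| step: "c \<in> F \<Longrightarrow> x \<in> monomial_span F t J \<Longrightarrow> c * (\<Prod>j\<in>J. t j ^ m j) + x \<in> monomial_span F t J"

context
  fixes F :: "'a::comm_ring_1 set" and t :: "'j \<Rightarrow> 'a" and J :: "'j set"
  assumes F: "subring_of F" and J: "finite J"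
begin

interpretation F: subring_of F by (fact F)

lemma monomial_span_monomial: "c \<in> F \<Longrightarrow> c * (\<Prod>j\<in>J. t j ^ m j) \<in> monomial_span F t J"
  using monomial_span.step[OF _ monomial_span.zero, where c = c and m = m] by simp

lemma monomial_span_const: "c \<in> F \<Longrightarrow> c \<in> monomial_span F t J"
  using monomial_span_monomial[of c "\<lambda>_. 0"] by simp

lemma monomial_span_gen: "i \<in> J \<Longrightarrow> t i \<in> monomial_span F t J"
  using monomial_span_monomial[OF F.one, of "\<lambda>j. if j = i then 1 else 0"] J
  by (simp add: prod.delta if_distrib[of "power _"] cong: if_cong)

lemma subring_of_monomial_span: "subring_of (monomial_span F t J)"
proof
  let ?R = "monomial_span F t J"
  show "1 \<in> ?R" by (rule monomial_span_const) (rule F.one)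
  show add: "x + y \<in> ?R" if "x \<in> ?R" "y \<in> ?R" for x y
    using that by (induction) (auto simp: add.assoc intro: monomial_span.step)
  have mono: "c * (\<Prod>j\<in>J. t j ^ m j) * y \<in> ?R" if "y \<in> ?R" "c \<in> F" for c m y
    using that
  proof (induction)
    case (step d y m')
    have "c * (\<Prod>j\<in>J. t j ^ m j) * (d * (\<Prod>j\<in>J. t j ^ m' j) + y) =
        (c * d) * (\<Prod>j\<in>J. t j ^ (m j + m' j)) + c * (\<Prod>j\<in>J. t j ^ m j) * y"
      by (simp add: power_add prod.distrib algebra_simps)
    with step show ?case by (auto intro!: monomial_span.step F.mult)
  qed (simp add: monomial_span.zero)
  show mult: "x * y \<in> ?R" if "x \<in> ?R" "y \<in> ?R" for x y
    using that by (induction) (auto simp: distrib_right intro: add mono monomial_span.zero)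
  show "- x \<in> ?R" if "x \<in> ?R" for x
    using mult[OF monomial_span_const[OF F.uminus[OF F.one]] that] by simp
qed

end

section \<open>Complex points of rational functions\<close>

text \<open>These are weights for Kronecker's substitution. The new variable gets weight 1 and the
  old weights are multiplied by a \<open>D\<close> exceeding all its exponents; remainder and
  quotient by \<open>D\<close> then recover both parts of an exponent vector.\<close>

lemma separating_weights:
  fixes S :: "('v \<Rightarrow> nat) set"
  assumes "finite V" "finite S"
  shows "\<exists>w. \<forall>m\<in>S. \<forall>m'\<in>S. (\<Sum>i\<in>V. w i * m i) = (\<Sum>i\<in>V. w i * m' i) \<longrightarrow> (\<forall>i\<in>V. m i = m' i)"
  using assms(1)
proof induction
  case (insert x V)
  then obtain w where w: "\<And>m m'. m \<in> S \<Longrightarrow> m' \<in> S \<Longrightarrow>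
      (\<Sum>i\<in>V. w i * m i) = (\<Sum>i\<in>V. w i * m' i) \<Longrightarrow> \<forall>i\<in>V. m i = m' i" by blast
  define D where "D = Suc (\<Sum>m\<in>S. m x)"
  have D: "m x < D" if "m \<in> S" for m
    using member_le_sum[OF that, of "\<lambda>m. m x"] assms(2) by (simp add: D_def)
  define w' where "w' i = (if i = x then 1 else D * w i)" for i
  have sum: "(\<Sum>i\<in>insert x V. w' i * m i) = m x + D * (\<Sum>i\<in>V. w i * m i)" for m
    using insert.hyps by (auto simp: w'_def sum_distrib_left mult.assoc intro!: sum.cong)
  have "\<forall>i\<in>insert x V. m i = m' i"
    if "m \<in> S" "m' \<in> S" and eq: "(\<Sum>i\<in>insert x V. w' i * m i) = (\<Sum>i\<in>insert x V. w' i * m' i)"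
    for m m'
  proof -
    have "m x = m' x" using arg_cong[OF eq, of "\<lambda>k. k mod D"] that(1,2) by (simp add: sum D)
    moreover have "(\<Sum>i\<in>V. w i * m i) = (\<Sum>i\<in>V. w i * m' i)"
      using arg_cong[OF eq, of "\<lambda>k. k div D"] D[OF that(1)] D[OF that(2)] by (simp add: sum)
    ultimately show ?thesis using w[OF that(1,2)] by auto
  qed
  then show ?case by blast
qed simp

lemma mpoly_eval_cong:
  assumes "\<And>m i. m \<in> Poly_Mapping.keys P \<Longrightarrow> i \<in> Poly_Mapping.keys m \<Longrightarrow> v i = v' i"
  shows "mpoly_eval \<iota> v P = mpoly_eval \<iota> v' P"
  unfolding mpoly_eval_def using assms by (intro sum.cong prod.cong arg_cong2[where f = "(*)"]) auto

text \<open>Substituting \<open>c ^ w i\<close> with separating weights sends distinct monomials of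
  \<open>P\<close> to distinct powers of \<open>c\<close>, which leaves a nonzero polynomial in one
  variable.\<close>

lemma mpoly_nonvanishing_point:
  fixes P :: "('v \<Rightarrow>\<^sub>0 nat) \<Rightarrow>\<^sub>0 complex"
  assumes "P \<noteq> 0"
  obtains v where "mpoly_eval (\<lambda>c. c) v P \<noteq> (0::complex)"
proof -
  define V where "V = (\<Union>m\<in>Poly_Mapping.keys P. Poly_Mapping.keys m)"
  have "finite V" by (simp add: V_def)
  then obtain w where w: "\<And>m m'. m \<in> Poly_Mapping.keys P \<Longrightarrow> m' \<in> Poly_Mapping.keys P \<Longrightarrow>
      (\<Sum>i\<in>V. w i * Poly_Mapping.lookup m i) = (\<Sum>i\<in>V. w i * Poly_Mapping.lookup m' i) \<Longrightarrow>
      \<forall>i\<in>V. Poly_Mapping.lookup m i = Poly_Mapping.lookup m' i"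
    using separating_weights[of V "Poly_Mapping.lookup ` Poly_Mapping.keys P"] by auto
  define k where "k m = (\<Sum>i\<in>V. w i * Poly_Mapping.lookup m i)" for m
  have inj: "m = m'" if "m \<in> Poly_Mapping.keys P" "m' \<in> Poly_Mapping.keys P" "k m = k m'" for m m'
  proof (rule poly_mapping_eqI)
    fix i
    show "Poly_Mapping.lookup m i = Poly_Mapping.lookup m' i"
    proof (cases "i \<in> V")
      case True
      then show ?thesis using w[of m m'] that by (simp add: k_def)
    next
      case False
      then have "i \<notin> Poly_Mapping.keys m" "i \<notin> Poly_Mapping.keys m'" using that by (auto simp: V_def)
      then show ?thesis by (simp add: in_keys_iff)
    qed
  qed
  define q where "q = (\<Sum>m\<in>Poly_Mapping.keys P. Polynomial.monom (Poly_Mapping.lookup P m) (k m))"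
  obtain m0 where m0: "m0 \<in> Poly_Mapping.keys P" using assms by fastforce
  have "poly.coeff q (k m0) = (\<Sum>m\<in>Poly_Mapping.keys P. if m = m0 then Poly_Mapping.lookup P m else 0)"
    unfolding q_def coeff_sum by (rule sum.cong) (use inj m0 in \<open>auto\<close>)
  also have "\<dots> = Poly_Mapping.lookup P m0" using m0 by simp
  finally have "q \<noteq> 0" using m0 by (auto simp: in_keys_iff)
  then obtain c where c: "poly q c \<noteq> 0" using poly_all_0_iff_0 by blast
  have "(\<Prod>i\<in>Poly_Mapping.keys m. (c ^ w i) ^ Poly_Mapping.lookup m i) = c ^ k m"
    if "m \<in> Poly_Mapping.keys P" for m
  proof -
    have "(\<Prod>i\<in>Poly_Mapping.keys m. (c ^ w i) ^ Poly_Mapping.lookup m i) =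
        (\<Prod>i\<in>V. (c ^ w i) ^ Poly_Mapping.lookup m i)"
      using \<open>finite V\<close> that by (intro prod.mono_neutral_left) (auto simp: V_def in_keys_iff)
    also have "\<dots> = c ^ k m" by (simp add: k_def power_sum power_mult)
    finally show ?thesis .
  qed
  then have "mpoly_eval (\<lambda>c. c) (\<lambda>i. c ^ w i) P = poly q c"
    by (simp add: mpoly_eval_def q_def poly_sum poly_monom)
  with c show ?thesis by (intro that[of "\<lambda>i. c ^ w i"]) simp
qed

text \<open>A relation, since a rational function has no value at a pole: some representation must
  have a denominator that does not vanish at \<open>x\<close>. Values are unique by
  \<open>evaluates_to_unique\<close>.\<close>

definition evaluates_to :: "(nat \<Rightarrow> complex) \<Rightarrow> ratfun \<Rightarrow> complex \<Rightarrow> bool" where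
  "evaluates_to x f c \<longleftrightarrow> (\<exists>A B. mpoly_eval (\<lambda>c. c) x B \<noteq> (0::complex) \<and> f = Fraction_Field.Fract A B \<and>
     c = mpoly_eval (\<lambda>c. c) x A / mpoly_eval (\<lambda>c. c) x B)"

lemma mpoly_eval_complex:
  fixes x :: "'v \<Rightarrow> complex"
  shows "mpoly_eval (\<lambda>c. c) x (P + Q) = mpoly_eval (\<lambda>c. c) x P + mpoly_eval (\<lambda>c. c) x Q"
    "mpoly_eval (\<lambda>c. c) x (P * Q) = mpoly_eval (\<lambda>c. c) x P * mpoly_eval (\<lambda>c. c) x Q"
    "mpoly_eval (\<lambda>c. c) x (Poly_Mapping.single m c) =
       c * (\<Prod>i\<in>Poly_Mapping.keys m. x i ^ Poly_Mapping.lookup m i)"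
    "mpoly_eval (\<lambda>c. c) x 1 = 1" "mpoly_eval (\<lambda>c. c) x 0 = 0"
proof -
  show *: "mpoly_eval (\<lambda>c. c) x (Poly_Mapping.single m c) =
       c * (\<Prod>i\<in>Poly_Mapping.keys m. x i ^ Poly_Mapping.lookup m i)" for m c
    by (rule mpoly_eval_single) simp
  show "mpoly_eval (\<lambda>c. c) x 1 = 1" using *[of 0 1] by simp
qed (simp_all add: mpoly_eval_add mpoly_eval_mult mpoly_eval_zero)

lemma evaluates_to_const: "evaluates_to x (rf_const c) c"
  unfolding evaluates_to_def rf_const_def
  by (intro exI conjI) (auto simp: mpoly_eval_complex)

lemma evaluates_to_var: "evaluates_to x (rf_var i) (x i)"
  unfolding evaluates_to_def rf_var_def
  by (intro exI conjI) (auto simp: mpoly_eval_complex)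

lemma mpoly_eval_nonzeroD: "mpoly_eval (\<lambda>c. c) x B \<noteq> (0::complex) \<Longrightarrow> B \<noteq> 0"
  by (auto simp: mpoly_eval_zero)

lemma ring_rel_evaluates_to: "ring_rel (evaluates_to x)"
proof
  show z: "evaluates_to x 0 0" and "evaluates_to x 1 1"
    using evaluates_to_const[of x 0] evaluates_to_const[of x 1] by (simp_all add: rf_const_hom)
  fix f c assume "evaluates_to x f c"
  then obtain A B where f: "mpoly_eval (\<lambda>c. c) x B \<noteq> 0" "f = Fraction_Field.Fract A B"
      "c = mpoly_eval (\<lambda>c. c) x A / mpoly_eval (\<lambda>c. c) x B"
    by (auto simp: evaluates_to_def)
  have "mpoly_eval (\<lambda>c. c) x (- A) + mpoly_eval (\<lambda>c. c) x A = 0"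
    by (simp flip: mpoly_eval_complex(1) add: mpoly_eval_complex(5))
  then have "mpoly_eval (\<lambda>c. c) x (- A) = - mpoly_eval (\<lambda>c. c) x A"
    by (simp add: eq_neg_iff_add_eq_0)
  then show "evaluates_to x (- f) (- c)"
    unfolding evaluates_to_def using f by (intro exI[of _ "- A"] exI[of _ B]) auto
  fix g d assume "evaluates_to x g d"
  then obtain A' B' where g: "mpoly_eval (\<lambda>c. c) x B' \<noteq> 0" "g = Fraction_Field.Fract A' B'"
      "d = mpoly_eval (\<lambda>c. c) x A' / mpoly_eval (\<lambda>c. c) x B'"
    by (auto simp: evaluates_to_def)
  note nz = mpoly_eval_nonzeroD[OF f(1)] mpoly_eval_nonzeroD[OF g(1)]
  show "evaluates_to x (f + g) (c + d)"
    unfolding evaluates_to_def using f g nz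
    by (intro exI[of _ "A * B' + A' * B"] exI[of _ "B * B'"])
      (simp add: mpoly_eval_complex add_frac_eq)
  show "evaluates_to x (f * g) (c * d)"
    unfolding evaluates_to_def using f g nz
    by (intro exI[of _ "A * A'"] exI[of _ "B * B'"]) (simp add: mpoly_eval_complex)
qed

lemma evaluates_to_inverse:
  assumes "evaluates_to x f c" "c \<noteq> 0"
  shows "evaluates_to x (inverse f) (inverse c)"
proof -
  obtain A B where "mpoly_eval (\<lambda>c. c) x B \<noteq> 0" "f = Fraction_Field.Fract A B"
      "c = mpoly_eval (\<lambda>c. c) x A / mpoly_eval (\<lambda>c. c) x B"
    using assms(1) by (auto simp: evaluates_to_def)
  with assms(2) show ?thesis
    unfolding evaluates_to_def by (intro exI[of _ B] exI[of _ A]) auto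
qed

lemma evaluates_to_divide:
  assumes "evaluates_to x f c" "evaluates_to x g d" "d \<noteq> 0"
  shows "evaluates_to x (f / g) (c / d)"
  using ring_rel.mult[OF ring_rel_evaluates_to assms(1) evaluates_to_inverse[OF assms(2,3)]]
  by (simp add: divide_inverse)

lemma evaluates_to_zero:
  assumes "evaluates_to x 0 c"
  shows "c = 0"
proof -
  obtain A B where *: "mpoly_eval (\<lambda>c. c) x B \<noteq> 0" "0 = Fraction_Field.Fract A B"
      "c = mpoly_eval (\<lambda>c. c) x A / mpoly_eval (\<lambda>c. c) x B"
    using assms by (auto simp: evaluates_to_def)
  then have "A = 0"
    using mpoly_eval_nonzeroD[of x B] by (simp add: Zero_fract_def eq_fract)
  with * show ?thesis by (simp add: mpoly_eval_complex)
qed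

lemma evaluates_to_unique:
  assumes "evaluates_to x f c" "evaluates_to x f d"
  shows "c = d"
  using evaluates_to_zero[of x "c - d"] ring_rel.diff[OF ring_rel_evaluates_to assms] by simp

text \<open>
  It suffices that the values of the family \<open>g\<close> at complex points are Zariski dense. The map
  \<open>idx\<close> names each element of \<open>g ` I\<close> by an index, so \<open>g\<close> need not be known to be injective.
\<close>

lemma alg_independent_if_dense_values:
  fixes g :: "'i \<Rightarrow> ratfun"
  assumes "\<And>(P :: (ratfun \<Rightarrow>\<^sub>0 nat) \<Rightarrow>\<^sub>0 complex) idx \<alpha>. mpoly_eval (\<lambda>c. c) (\<lambda>b. \<alpha> (idx b)) P \<noteq> 0 \<Longrightarrow>
    \<exists>x \<beta>. mpoly_eval (\<lambda>c. c) (\<lambda>b. \<beta> (idx b)) P \<noteq> 0 \<and> (\<forall>i\<in>I. evaluates_to x (g i) (\<beta> i))"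
  shows "alg_independent rf_const (g ` I)"
  unfolding alg_independent_def
proof (intro allI impI, elim conjE, rule ccontr)
  fix P :: "(ratfun \<Rightarrow>\<^sub>0 nat) \<Rightarrow>\<^sub>0 complex"
  assume keys: "\<forall>m\<in>Poly_Mapping.keys P. Poly_Mapping.keys m \<subseteq> g ` I"
    and P: "mpoly_eval rf_const (\<lambda>b. b) P = 0" "P \<noteq> 0"
  define idx where "idx = inv_into I g"
  have idx: "idx b \<in> I" "g (idx b) = b" if "b \<in> g ` I" for b
    using that by (auto simp: idx_def inv_into_into f_inv_into_f)
  obtain v where v: "mpoly_eval (\<lambda>c. c) v P \<noteq> (0::complex)"
    using P(2) by (rule mpoly_nonvanishing_point)
  have "mpoly_eval (\<lambda>c. c) (\<lambda>b. v (g (idx b))) P = mpoly_eval (\<lambda>c. c) v P"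
    by (rule mpoly_eval_cong) (use keys idx in force)
  then obtain x \<beta> where \<beta>: "mpoly_eval (\<lambda>c. c) (\<lambda>b. \<beta> (idx b)) P \<noteq> 0"
      "\<And>i. i \<in> I \<Longrightarrow> evaluates_to x (g i) (\<beta> i)"
    using assms[of "\<lambda>i. v (g i)" idx P] v by auto
  have "evaluates_to x (mpoly_eval rf_const (\<lambda>b. b) P) (mpoly_eval (\<lambda>c. c) (\<lambda>b. \<beta> (idx b)) P)"
    by (rule ring_rel.mpoly_eval[OF ring_rel_evaluates_to evaluates_to_const])
      (use \<beta>(2) idx keys in force)
  with P(1) \<beta>(1) evaluates_to_zero show False by metis
qed

section \<open>Constants and the action by permuting variables\<close>

lemma rf_const_minus: "rf_const (- c) = - rf_const c"
  using rf_const_hom(1) rf_const_hom(3)[of "- c" c] by (simp add: eq_neg_iff_add_eq_0)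

lemma rf_const_eq_0_iff: "rf_const c = 0 \<longleftrightarrow> c = 0"
proof
  assume "rf_const c = 0"
  then show "c = 0" using evaluates_to_const[of undefined c] evaluates_to_zero by metis
qed (simp add: rf_const_hom)

lemma rf_const_eq_iff: "rf_const c = rf_const d \<longleftrightarrow> c = d"
  using evaluates_to_const evaluates_to_unique by metis

lemma rf_const_of_nat: "rf_const (of_nat k) = of_nat k"
  by (induction k) (simp_all add: rf_const_hom)

lemma ring_rel_rf_const: "ring_rel (\<lambda>c f. f = rf_const c)"
  by unfold_locales (simp_all add: rf_const_hom rf_const_minus)

lemma ring_rel_perm_act:
  assumes "inj \<sigma>"
  shows "ring_rel (\<lambda>f g. g = perm_act \<sigma> f)"
proof
  show "0 = perm_act \<sigma> 0" "1 = perm_act \<sigma> 1"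
    using perm_act_hom(1)[OF assms, of 0] perm_act_hom(1)[OF assms, of 1]
    by (simp_all add: rf_const_hom)
  fix f g assume "g = perm_act \<sigma> f"
  moreover have "perm_act \<sigma> (rf_const (- 1) * f) = rf_const (- 1) * perm_act \<sigma> f"
    by (simp only: perm_act_hom[OF assms])
  ultimately show "- g = perm_act \<sigma> (- f)" by (simp add: rf_const_minus rf_const_hom)
qed (simp_all add: perm_act_hom[OF assms])

lemma perm_act_divide:
  assumes "inj \<sigma>"
  shows "perm_act \<sigma> (f / g) = perm_act \<sigma> f / perm_act \<sigma> g"
proof (cases "g = 0")
  case False
  have 0: "perm_act \<sigma> 0 = 0" and 1: "perm_act \<sigma> 1 = 1"
    using ring_rel.zero[OF ring_rel_perm_act[OF assms]] ring_rel.one[OF ring_rel_perm_act[OF assms]]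
    by simp_all
  have "perm_act \<sigma> (inverse g) * perm_act \<sigma> g = 1"
    using False 1 by (simp flip: perm_act_hom(4)[OF assms])
  then have "perm_act \<sigma> g \<noteq> 0" by auto
  moreover have "perm_act \<sigma> (f / g) * perm_act \<sigma> g = perm_act \<sigma> f"
    using False by (simp flip: perm_act_hom(4)[OF assms])
  ultimately show ?thesis by (simp add: field_simps)
next
  case True
  then show ?thesis
    using ring_rel.zero[OF ring_rel_perm_act[OF assms]] by simp
qed

lemma perm_act_comp:
  assumes "inj \<sigma>" "inj \<rho>"
  shows "perm_act (\<sigma> \<circ> \<rho>) f = perm_act \<sigma> (perm_act \<rho> f)"
proof -
  have *: "perm_act \<sigma> (mpoly_eval rf_const (\<lambda>i. rf_var (\<rho> i)) P) =
      mpoly_eval rf_const (\<lambda>i. rf_var (\<sigma> (\<rho> i))) P" for P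
    by (rule ring_rel.mpoly_eval[OF ring_rel_perm_act[OF assms(1)], symmetric])
      (simp_all add: perm_act_hom assms)
  obtain P Q where "f = Fraction_Field.Fract P Q" "Q \<noteq> 0" by (meson Fract_cases)
  then show ?thesis
    using assms by (simp add: perm_act_Fract inj_compose perm_act_divide *)
qed

lemma perm_act_id: "perm_act id f = f"
proof -
  obtain P Q where "f = Fraction_Field.Fract P Q" "Q \<noteq> 0" by (meson Fract_cases)
  then show ?thesis by (simp add: perm_act_Fract mpoly_eval_id)
qed

section \<open>Vandermonde systems and roots of unity\<close>

lemma root_poly_remove_eval:
  fixes u :: "'i \<Rightarrow> 'a::idom"
  assumes "finite J" "j \<in> J" "l \<in> J" "l \<noteq> j"
  shows "poly (root_poly u (J - {j})) (u l) = 0"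
  using assms by (auto simp: poly_root_poly)

lemma root_poly_remove_nonzero:
  fixes u :: "'i \<Rightarrow> 'a::idom"
  assumes "finite J" "j \<in> J" "inj_on u J"
  shows "poly (root_poly u (J - {j})) (u j) \<noteq> 0"
  using assms by (auto simp: poly_root_poly inj_on_def)

lemma poly_root_poly_remove_altdef:
  fixes u :: "'i \<Rightarrow> 'a::idom"
  assumes "finite J" "j \<in> J"
  shows "poly (root_poly u (J - {j})) x = (\<Sum>i<card J. poly.coeff (root_poly u (J - {j})) i * x ^ i)"
proof -
  have "card J = Suc (card (J - {j}))" using assms by (metis card.remove)
  then have "{..<card J} = {..degree (root_poly u (J - {j}))}"
    by (simp add: degree_root_poly lessThan_Suc_atMost)
  then show ?thesis by (simp only: poly_altdef)
qed

text \<open>The polynomial whose roots are the other \<open>u l\<close> annihilates every term but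
  the one at \<open>j\<close>, so the moments determine \<open>z j\<close> up to an explicit
  factor.\<close>

lemma vandermonde_left_inverse:
  fixes u z :: "'i \<Rightarrow> 'a::idom"
  assumes "finite J" "j \<in> J"
  shows "(\<Sum>i<card J. poly.coeff (root_poly u (J - {j})) i * (\<Sum>l\<in>J. z l * u l ^ i)) =
    z j * poly (root_poly u (J - {j})) (u j)"
proof -
  have "(\<Sum>i<card J. poly.coeff (root_poly u (J - {j})) i * (\<Sum>l\<in>J. z l * u l ^ i)) =
      (\<Sum>l\<in>J. z l * poly (root_poly u (J - {j})) (u l))"
    by (simp only: poly_root_poly_remove_altdef[OF assms] sum_distrib_left)
      (subst sum.swap, simp add: mult_ac)
  also have "\<dots> = (\<Sum>l\<in>J. if l = j then z j * poly (root_poly u (J - {j})) (u j) else 0)"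
    by (rule sum.cong) (use assms root_poly_remove_eval[OF assms] in auto)
  finally show ?thesis using assms by simp
qed

text \<open>The inverse matrix consists of the coefficients of the Lagrange basis polynomials
  \<open>B j / D j\<close>; that it is a right inverse is the interpolation formula for the powers
  \<open>X ^ i\<close>.\<close>

lemma vandermonde_solvable:
  fixes u :: "'i \<Rightarrow> 'a::field"
  assumes "finite J" "inj_on u J"
  shows "\<exists>z. \<forall>i<card J. (\<Sum>j\<in>J. z j * u j ^ i) = \<alpha> i"
proof -
  define B where "B j = root_poly u (J - {j})" for j
  define D where "D j = poly (B j) (u j)" for j
  have D: "D j \<noteq> 0" if "j \<in> J" for j
    using root_poly_remove_nonzero[OF assms(1) that assms(2)] by (simp add: D_def B_def)
  define z where "z j = (\<Sum>m<card J. poly.coeff (B j) m * \<alpha> m) / D j" for j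
  have "(\<Sum>j\<in>J. z j * u j ^ i) = \<alpha> i" if i: "i < card J" for i
  proof -
    \<comment> \<open>Both sides have degree below \<open>card J\<close> and agree at the
      \<open>card J\<close> distinct points \<open>u j\<close>.\<close>
    have "(\<Sum>j\<in>J. smult (u j ^ i / D j) (B j)) = Polynomial.monom 1 i"
    proof (rule poly_eqI_degree[where A = "u ` J"])
      fix x assume "x \<in> u ` J"
      then obtain l where l: "l \<in> J" "x = u l" by blast
      have "(\<Sum>j\<in>J. u j ^ i / D j * poly (B j) (u l)) = (\<Sum>j\<in>J. if j = l then u l ^ i else 0)"
        by (rule sum.cong) (use l D root_poly_remove_eval[OF assms(1)] in \<open>auto simp: B_def D_def\<close>)
      then show "poly (\<Sum>j\<in>J. smult (u j ^ i / D j) (B j)) x = poly (Polynomial.monom 1 i) x"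
        using l assms(1) by (simp add: poly_sum poly_monom)
    next
      have "degree (\<Sum>j\<in>J. smult (u j ^ i / D j) (B j)) \<le> card J - 1"
        by (rule degree_sum_le)
          (use assms(1) in \<open>auto simp: B_def degree_root_poly intro!: order.trans[OF degree_smult_le]\<close>)
      then show "card (u ` J) > degree (\<Sum>j\<in>J. smult (u j ^ i / D j) (B j))"
        using i by (simp add: card_image assms(2))
      show "card (u ` J) > degree (Polynomial.monom (1::'a) i)"
        using i by (simp add: card_image assms(2) degree_monom_eq)
    qed
    then have "poly.coeff (\<Sum>j\<in>J. smult (u j ^ i / D j) (B j)) m = poly.coeff (Polynomial.monom 1 i) m" for m
      by simp
    then have *: "(\<Sum>j\<in>J. u j ^ i / D j * poly.coeff (B j) m) = (if i = m then 1 else 0)" for m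
      by (simp only: coeff_sum coeff_smult coeff_monom)
    have "(\<Sum>j\<in>J. z j * u j ^ i) = (\<Sum>j\<in>J. \<Sum>m<card J. \<alpha> m * (u j ^ i / D j * poly.coeff (B j) m))"
      by (simp add: z_def sum_divide_distrib sum_distrib_right sum_distrib_left mult_ac)
    also have "\<dots> = (\<Sum>m<card J. \<alpha> m * (\<Sum>j\<in>J. u j ^ i / D j * poly.coeff (B j) m))"
      by (subst sum.swap) (simp add: sum_distrib_left)
    also have "\<dots> = (\<Sum>m<card J. if i = m then \<alpha> m else 0)"
      unfolding * by (rule sum.cong) simp_all
    also have "\<dots> = \<alpha> i" using i by simp
    finally show ?thesis .
  qed
  then show ?thesis by blast
qed

text \<open>The product fixes the constant coefficient and the others are free, so the corresponding
  monic polynomial is factored and \<open>p\<close>-th roots of its roots are taken. Their product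
  has the right \<open>p\<close>-th power, and the leftover root of unity is absorbed into one of
  them.\<close>

lemma complex_roots_with_prescribed_product:
  fixes w :: complex and a :: "nat \<Rightarrow> complex"
  assumes "n \<ge> 1" "p > 0"
  obtains t :: "nat \<Rightarrow> complex" where "(\<Prod>j=1..n. t j) = w"
    "\<And>i. i \<in> {1..<n} \<Longrightarrow> poly.coeff (root_poly (\<lambda>j. t j ^ p) {1..n}) i = a i"
proof -
  define b where "b i = (if i = 0 then (-1) ^ n * w ^ p else if i = n then 1 else a i)" for i
  define A where "A = (\<Sum>i\<le>n. Polynomial.monom (b i) i)"
  have coeff_A: "poly.coeff A i = (if i \<le> n then b i else 0)" for i
    by (simp add: A_def coeff_sum)
  have "degree A = n"
    by (rule antisym) (use assms in \<open>auto intro!: degree_le le_degree simp: coeff_A b_def\<close>)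
  moreover have "poly.coeff A n = 1" using assms by (simp add: coeff_A b_def)
  moreover have "A \<noteq> 0" using calculation(2) by auto
  ultimately obtain M where M: "size M = n" "A = (\<Prod>x\<in>#M. [:-x, 1:])"
    using alg_closed_imp_factorization[of A] by auto
  obtain xs where xs: "mset xs = M" using ex_mset by blast
  define c where "c j = xs ! (j - 1)" for j
  have "A = prod_list (map (\<lambda>x. [:-x, 1:]) xs)"
    unfolding M(2) xs[symmetric] by (simp flip: prod_mset_prod_list)
  also have "\<dots> = (\<Prod>i=0..<n. [:- xs ! i, 1:])"
    using M(1) xs by (auto simp: prod.list_conv_set_nth intro!: prod.cong)
  also have "\<dots> = root_poly c {1..n}"
    unfolding root_poly_def c_def
    by (rule prod.reindex_bij_witness[where i = "\<lambda>j. j - 1" and j = Suc]) auto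
  finally have A: "A = root_poly c {1..n}" .
  have "\<exists>s. \<forall>j. s j ^ p = c j" by (intro choice allI nth_root_exists assms(2))
  then obtain s where s: "\<And>j. s j ^ p = c j" by blast
  have "(-1) ^ n * w ^ p = (-1) ^ n * (\<Prod>j=1..n. c j)"
    using coeff_A[of 0] coeff_root_poly_0[of c "{1..n}"] by (simp add: A b_def)
  then have c: "(\<Prod>j=1..n. c j) = w ^ p" by simp
  then have prod_s: "(\<Prod>j=1..n. s j) ^ p = w ^ p" by (simp add: s prod_power_distrib)
  \<comment> \<open>For \<open>w = 0\<close> the product of the \<open>s j\<close> already vanishes.
    Otherwise this is a \<open>p\<close>-th root of unity, so multiplying \<open>s 1\<close> by it
    leaves the \<open>p\<close>-th powers unchanged.\<close>
  define \<xi> where "\<xi> = (if w = 0 then 1 else w / (\<Prod>j=1..n. s j))"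
  define t where "t j = (if j = 1 then \<xi> * s j else s j)" for j
  have nz: "(\<Prod>j=1..n. s j) \<noteq> 0 \<longleftrightarrow> w \<noteq> 0"
    using prod_s assms(2) by (metis power_eq_0_iff)
  have \<xi>: "\<xi> ^ p = 1" using nz prod_s by (auto simp: \<xi>_def power_divide)
  show ?thesis
  proof (rule that[of t])
    have "(\<Prod>j=1..n. t j) = (\<Prod>j=1..n. (if j = 1 then \<xi> else 1) * s j)"
      by (rule prod.cong) (auto simp: t_def)
    also have "\<dots> = \<xi> * (\<Prod>j=1..n. s j)"
      using assms(1) by (simp only: prod.distrib) simp
    also have "\<dots> = w" using nz by (auto simp: \<xi>_def)
    finally show "(\<Prod>j=1..n. t j) = w" .
    have "(\<lambda>j. t j ^ p) = c" using \<xi> s by (auto simp: t_def power_mult_distrib)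
    then show "poly.coeff (root_poly (\<lambda>j. t j ^ p) {1..n}) i = a i" if "i \<in> {1..<n}" for i
      using coeff_A[of i] that by (auto simp: A b_def)
  qed
qed

section \<open>Roots of unity and orthogonality for the Fourier transform\<close>

definition unity_root :: "nat \<Rightarrow> complex" where
  "unity_root p = cis (2 * pi / real p)"

lemma unity_root_power: "unity_root p ^ k = cis (2 * pi * real k / real p)"
  by (simp add: unity_root_def Complex.DeMoivre mult_ac)

context
  fixes p :: nat
  assumes p: "p > 0"
begin

lemma unity_root_power_p: "unity_root p ^ p = 1"
  using p by (simp add: unity_root_power)

lemma unity_root_nonzero: "unity_root p \<noteq> 0"
  by (simp add: unity_root_def)

lemma unity_root_power_mod: "unity_root p ^ (k mod p) = unity_root p ^ k"
proof -
  have "unity_root p ^ k = unity_root p ^ (p * (k div p) + k mod p)" by simp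
  then show ?thesis by (simp only: power_add power_mult unity_root_power_p power_one mult_1)
qed

lemma unity_root_power_eq_iff: "unity_root p ^ a = unity_root p ^ b \<longleftrightarrow> a mod p = b mod p"
proof
  have "inj_on (\<lambda>k. unity_root p ^ k) {..<p}"
    using bij_betw_roots_unity[OF p] by (simp add: bij_betw_def unity_root_power)
  moreover assume "unity_root p ^ a = unity_root p ^ b"
  then have "unity_root p ^ (a mod p) = unity_root p ^ (b mod p)" by (simp add: unity_root_power_mod)
  ultimately show "a mod p = b mod p" using p by (auto dest: inj_onD)
qed (metis unity_root_power_mod)

text \<open>A geometric series whose ratio \<open>?q\<close> is a \<open>p\<close>-th root of unity,
  equal to 1 exactly when \<open>a = b\<close>.\<close>

lemma dft_orthogonality:
  assumes "a < p" "b < p"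
  shows "(\<Sum>k<p. unity_root p ^ (k * a) * inverse (unity_root p) ^ (k * b)) =
    (if a = b then of_nat p else 0)"
proof -
  let ?q = "unity_root p ^ a * inverse (unity_root p) ^ b"
  have sum: "(\<Sum>k<p. unity_root p ^ (k * a) * inverse (unity_root p) ^ (k * b)) = (\<Sum>k<p. ?q ^ k)"
    by (simp add: power_mult_distrib mult.commute flip: power_mult)
  have q: "?q = 1 \<longleftrightarrow> a = b"
  proof -
    have "?q = 1 \<longleftrightarrow> unity_root p ^ a = unity_root p ^ b"
      using unity_root_nonzero by (simp add: power_inverse field_simps)
    then show ?thesis using assms by (simp add: unity_root_power_eq_iff)
  qed
  have "(unity_root p ^ a) ^ p = 1" "(unity_root p ^ b) ^ p = 1"
    by (metis mult.commute power_mult power_one unity_root_power_p)+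
  then have "?q ^ p = 1" by (simp add: power_mult_distrib power_inverse)
  then show ?thesis
    using geometric_sum[of ?q p] q unfolding sum by auto
qed

lemma bij_betw_add_mod: "bij_betw (\<lambda>r. (r + s) mod p) {..<p} {..<p}"
proof -
  have "inj_on (\<lambda>r. (r + s) mod p) {..<p}"
  proof (rule inj_onI)
    fix r r' assume "r \<in> {..<p}" "r' \<in> {..<p}" "(r + s) mod p = (r' + s) mod p"
    then have "unity_root p ^ r * unity_root p ^ s = unity_root p ^ r' * unity_root p ^ s"
      by (simp add: unity_root_power_eq_iff flip: power_add)
    then have "unity_root p ^ r = unity_root p ^ r'" using unity_root_nonzero by simp
    with \<open>r \<in> {..<p}\<close> \<open>r' \<in> {..<p}\<close> show "r = r'" by (simp add: unity_root_power_eq_iff)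
  qed
  moreover have "(\<lambda>r. (r + s) mod p) ` {..<p} \<subseteq> {..<p}" using p by auto
  ultimately show ?thesis by (simp add: bij_betw_def endo_inj_surj)
qed

end

section \<open>The generators\<close>

datatype gen_index = Prod_gen | Coeff_gen nat | Moment_gen nat nat

locale wreath_invariants =
  fixes n p :: nat
  assumes n: "n \<ge> 1" and prime_p: "prime p"
begin

lemma p_gt_1: "p > 1"
  using prime_p by (rule prime_gt_1_nat)

lemma p_pos: "p > 0"
  using p_gt_1 by simp

abbreviation "J \<equiv> {1..n}"
abbreviation "\<omega> \<equiv> unity_root p"

definition V :: "nat \<Rightarrow> nat \<Rightarrow> ratfun" where
  "V j r = rf_var ((j - 1) * p + r + 1)"

definition Y :: "nat \<Rightarrow> nat \<Rightarrow> ratfun" where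
  "Y j k = (\<Sum>r<p. rf_const (inverse \<omega> ^ (k * r)) * V j r)"

definition T :: "nat \<Rightarrow> ratfun" where "T j = Y j 1"

definition U :: "nat \<Rightarrow> ratfun" where "U j = T j ^ p"

definition Z :: "nat \<Rightarrow> nat \<Rightarrow> ratfun" where "Z j k = Y j k / T j ^ k"

definition W :: ratfun where "W = (\<Prod>j\<in>J. T j)"

definition M :: "nat \<Rightarrow> nat \<Rightarrow> ratfun" where "M k i = (\<Sum>j\<in>J. Z j k * U j ^ i)"

text \<open>Left out are \<open>k = 1\<close>, where \<open>Z j 1 = 1\<close>, and the coefficients
  0 and \<open>n\<close>, which are \<open>(-1) ^ n * W ^ p\<close> and 1. There remain
  \<open>1 + (n - 1) + (p - 1) * n = n * p\<close> indices, as many as there are variables.\<close>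

definition I :: "gen_index set" where
  "I = insert Prod_gen (Coeff_gen ` {1..<n} \<union> case_prod Moment_gen ` (({..<p} - {1}) \<times> {..<n}))"

fun gen :: "gen_index \<Rightarrow> ratfun" where
  "gen Prod_gen = W"
| "gen (Coeff_gen i) = poly.coeff (root_poly U J) i"
| "gen (Moment_gen k i) = M k i"

lemma finite_I: "finite I" by (simp add: I_def)

section \<open>Values of the Fourier coordinates and independence of the generators\<close>

text \<open>The point \<open>x\<close> is the inverse Fourier transform of the prescribed values,
  block by block.\<close>

lemma evaluates_to_Y:
  fixes y :: "nat \<Rightarrow> nat \<Rightarrow> complex"
  shows "\<exists>x. \<forall>j k. j \<in> J \<longrightarrow> k < p \<longrightarrow> evaluates_to x (Y j k) (y j k)"
proof (intro exI allI impI)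
  define v where "v j r = (\<Sum>k<p. \<omega> ^ (k * r) * y j k) / of_nat p" for j r
  define x where "x i = v ((i - 1) div p + 1) ((i - 1) mod p)" for i
  fix j k assume j: "j \<in> J" and k: "k < p"
  have V: "evaluates_to x (V j r) (v j r)" if "r < p" for r
    using evaluates_to_var[of x "(j - 1) * p + r + 1"] block_elem[OF j that] j
    by (simp add: V_def x_def)
  have "evaluates_to x (Y j k) (\<Sum>r<p. inverse \<omega> ^ (k * r) * v j r)"
    unfolding Y_def using V
    by (intro ring_rel.sum[OF ring_rel_evaluates_to] ring_rel.mult[OF ring_rel_evaluates_to]
        evaluates_to_const) auto
  also have "(\<Sum>r<p. inverse \<omega> ^ (k * r) * v j r) =
      (\<Sum>r<p. \<Sum>l<p. y j l / of_nat p * (\<omega> ^ (r * l) * inverse \<omega> ^ (r * k)))"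
    by (simp add: v_def sum_distrib_left sum_divide_distrib mult_ac)
  also have "\<dots> = (\<Sum>l<p. y j l / of_nat p * (\<Sum>r<p. \<omega> ^ (r * l) * inverse \<omega> ^ (r * k)))"
    by (subst sum.swap) (simp only: sum_distrib_left)
  also have "\<dots> = (\<Sum>l<p. if l = k then y j k else 0)"
    by (rule sum.cong) (use p_pos k in \<open>auto simp: dft_orthogonality[OF p_pos _ k]\<close>)
  also have "\<dots> = y j k" using k by simp
  finally show "evaluates_to x (Y j k) (y j k)" .
qed

text \<open>Fourier inversion; it puts the variables into every subfield containing the constants
  and the \<open>Y j k\<close>.\<close>

lemma V_eq_Y:
  assumes "r < p"
  shows "V j r = (\<Sum>k<p. rf_const (\<omega> ^ (k * r)) * Y j k) / of_nat p"
proof -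
  have orth: "(\<Sum>k<p. rf_const (\<omega> ^ (k * r) * inverse \<omega> ^ (k * l))) =
      (if r = l then of_nat p else 0)" if "l < p" for l
  proof -
    have "(\<Sum>k<p. rf_const (\<omega> ^ (k * r) * inverse \<omega> ^ (k * l))) =
        rf_const (\<Sum>k<p. \<omega> ^ (k * r) * inverse \<omega> ^ (k * l))"
      by (rule ring_rel.sum[OF ring_rel_rf_const]) simp
    then show ?thesis
      by (simp add: dft_orthogonality[OF p_pos assms that] rf_const_of_nat rf_const_hom)
  qed
  have "(\<Sum>k<p. rf_const (\<omega> ^ (k * r)) * Y j k) =
      (\<Sum>k<p. \<Sum>l<p. V j l * rf_const (\<omega> ^ (k * r) * inverse \<omega> ^ (k * l)))"
    by (simp add: Y_def sum_distrib_left rf_const_hom mult_ac)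
  also have "\<dots> = (\<Sum>l<p. V j l * (\<Sum>k<p. rf_const (\<omega> ^ (k * r) * inverse \<omega> ^ (k * l))))"
    by (subst sum.swap) (simp only: sum_distrib_left)
  also have "\<dots> = (\<Sum>l<p. if l = r then V j r * of_nat p else 0)"
    by (rule sum.cong) (auto simp: orth)
  also have "\<dots> = V j r * of_nat p" using assms by simp
  finally show ?thesis
    using p_pos rf_const_eq_0_iff[of "of_nat p"] by (simp add: rf_const_of_nat)
qed

lemma T_nonzero: "j \<in> J \<Longrightarrow> T j \<noteq> 0"
proof
  assume j: "j \<in> J" and "T j = 0"
  obtain x where "\<And>j k. j \<in> J \<Longrightarrow> k < p \<Longrightarrow> evaluates_to x (Y j k) 1"
    using evaluates_to_Y[of "\<lambda>_ _. 1"] by blast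
  from this[OF j p_gt_1] \<open>T j = 0\<close> show False
    using evaluates_to_zero[of x 1] by (simp add: T_def)
qed

text \<open>Tested at a point where \<open>T j\<close> takes the value \<open>j\<close>, so that the
  \<open>U j\<close> take distinct values \<open>j ^ p\<close>.\<close>

lemma inj_on_U: "inj_on U J"
proof (rule inj_onI)
  fix i j assume ij: "i \<in> J" "j \<in> J" "U i = U j"
  obtain x where x: "\<And>j k. j \<in> J \<Longrightarrow> k < p \<Longrightarrow> evaluates_to x (Y j k) (of_nat j)"
    using evaluates_to_Y[of "\<lambda>j _. of_nat j"] by blast
  have "evaluates_to x (U j) (of_nat j ^ p)" if "j \<in> J" for j
    unfolding U_def T_def using x[OF that p_gt_1] by (rule ring_rel.power[OF ring_rel_evaluates_to])
  then have "of_nat i ^ p = (of_nat j ^ p :: complex)"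
    using ij evaluates_to_unique by metis
  then have "i ^ p = j ^ p" by (metis of_nat_eq_iff of_nat_power)
  then show "i = j" using p_pos by (simp add: power_eq_iff_eq_base)
qed

text \<open>A point with the prescribed product and coefficients may have zero or repeated
  \<open>t j ^ p\<close>, and then the moments cannot be prescribed freely. Moving along a line
  towards a good point repairs this: \<open>P\<close> does not vanish at the start, hence at only
  finitely many points of the line.\<close>

lemma gen_values_dense:
  fixes P :: "(ratfun \<Rightarrow>\<^sub>0 nat) \<Rightarrow>\<^sub>0 complex"
  assumes P: "mpoly_eval (\<lambda>c. c) (\<lambda>b. \<alpha> (idx b)) P \<noteq> 0"
  shows "\<exists>x \<beta>. mpoly_eval (\<lambda>c. c) (\<lambda>b. \<beta> (idx b)) P \<noteq> 0 \<and> (\<forall>i\<in>I. evaluates_to x (gen i) (\<beta> i))"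
proof -
  obtain t0 :: "nat \<Rightarrow> complex" where t0: "(\<Prod>j\<in>J. t0 j) = \<alpha> Prod_gen"
    "\<And>i. i \<in> {1..<n} \<Longrightarrow> poly.coeff (root_poly (\<lambda>j. t0 j ^ p) J) i = \<alpha> (Coeff_gen i)"
    using complex_roots_with_prescribed_product[OF n p_pos,
        where w = "\<alpha> Prod_gen" and a = "\<lambda>i. \<alpha> (Coeff_gen i)"] by metis
  \<comment> \<open>the line from \<open>t0\<close> to the point \<open>(1, \<dots>, n)\<close>, whose coordinates have distinct nonzero \<open>p\<close>-th powers\<close>
  define L :: "nat \<Rightarrow> complex poly" where "L j = [:t0 j, of_nat j - t0 j:]" for j
  \<comment> \<open>Target values along the line: the product and the coefficients follow
    \<open>L\<close>, while the moments, solved for last, stay constant.\<close>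
  define \<gamma> :: "gen_index \<Rightarrow> complex poly" where
    "\<gamma> g = (if g = Prod_gen then \<Prod>j\<in>J. L j
        else if g \<in> Coeff_gen ` {1..<n} then (case g of Coeff_gen i \<Rightarrow> poly.coeff (root_poly (\<lambda>j. L j ^ p) J) i)
        else [:\<alpha> g:])" for g
  have ev: "ring_rel (\<lambda>q y. y = poly q c)" for c :: complex
    by unfold_locales simp_all
  define H where "H = mpoly_eval (\<lambda>c. [:c:]) (\<lambda>b. \<gamma> (idx b)) P"
  have H: "poly H c = mpoly_eval (\<lambda>c. c) (\<lambda>b. poly (\<gamma> (idx b)) c) P" for c
    unfolding H_def by (rule ring_rel.mpoly_eval[OF ev, symmetric]) simp_all
  have coeff: "poly (poly.coeff (root_poly (\<lambda>j. L j ^ p) J) i) c =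
      poly.coeff (root_poly (\<lambda>j. poly (L j) c ^ p) J) i" for i c
    by (rule ring_rel.coeff_root_poly[OF ev, symmetric]) simp
  have "poly (L j) 0 = t0 j" for j by (simp add: L_def)
  then have "poly (\<gamma> g) 0 = \<alpha> g" for g
    using t0 by (auto simp: \<gamma>_def poly_prod coeff simp del: One_nat_def)
  then have "poly H 0 \<noteq> 0" using P by (simp add: H)
  then have "H \<noteq> 0" by auto
  \<comment> \<open>Where \<open>D\<close> does not vanish, the coordinates are nonzero with
    distinct \<open>p\<close>-th powers. The end point \<open>(1, \<dots>, n)\<close> shows that
    \<open>D\<close> is not the zero polynomial.\<close>
  define D where "D = (\<Prod>j\<in>J. L j) * (\<Prod>i\<in>J. \<Prod>j\<in>J - {i}. L i ^ p - L j ^ p)"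
  have "(of_nat i ^ p :: complex) \<noteq> of_nat j ^ p" if "i \<noteq> j" for i j :: nat
  proof -
    have "i ^ p \<noteq> j ^ p" using that p_pos by (simp add: power_eq_iff_eq_base)
    then show ?thesis by (metis of_nat_eq_iff of_nat_power)
  qed
  then have "poly D 1 \<noteq> 0"
    by (auto simp: D_def L_def poly_prod)
  then have "D \<noteq> 0" by auto
  with \<open>H \<noteq> 0\<close> have "H * D \<noteq> 0" by simp
  then obtain c where c: "poly (H * D) c \<noteq> 0" using poly_all_0_iff_0 by blast
  define t where "t j = poly (L j) c" for j
  define \<beta> where "\<beta> g = poly (\<gamma> g) c" for g
  have t_nz: "t j \<noteq> 0" if "j \<in> J" for j using c that by (auto simp: D_def poly_prod t_def)
  have inj: "inj_on (\<lambda>j. t j ^ p) J"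
    using c by (auto simp: inj_on_def D_def poly_prod t_def)
  have "\<exists>z. \<forall>k. \<forall>i<n. (\<Sum>j\<in>J. z k j * (t j ^ p) ^ i) = \<alpha> (Moment_gen k i)"
    by (rule choice) (use vandermonde_solvable[OF _ inj] in simp)
  then obtain z where z: "\<And>k i. i < n \<Longrightarrow> (\<Sum>j\<in>J. z k j * (t j ^ p) ^ i) = \<alpha> (Moment_gen k i)"
    by blast
  \<comment> \<open>The value at \<open>k = 1\<close> is that of \<open>T j\<close>; for other
    \<open>k\<close> the factor \<open>t j ^ k\<close> cancels in \<open>Z j k\<close> and leaves
    \<open>z k j\<close>.\<close>
  obtain x where x: "\<And>j k. j \<in> J \<Longrightarrow> k < p \<Longrightarrow>
      evaluates_to x (Y j k) (if k = 1 then t j else z k j * t j ^ k)"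
    using evaluates_to_Y[of "\<lambda>j k. if k = 1 then t j else z k j * t j ^ k"] by blast
  interpret E: ring_rel "evaluates_to x" by (rule ring_rel_evaluates_to)
  have T: "evaluates_to x (T j) (t j)" if "j \<in> J" for j
    using x[OF that p_gt_1] by (simp add: T_def)
  have U: "evaluates_to x (U j) (t j ^ p)" if "j \<in> J" for j
    unfolding U_def using T[OF that] by (rule E.power)
  have Z: "evaluates_to x (Z j k) (z k j)" if "j \<in> J" "k < p" "k \<noteq> 1" for j k
    using evaluates_to_divide[OF x[OF that(1,2)] E.power[OF T[OF that(1)], of k]] that t_nz[OF that(1)]
    by (simp add: Z_def)
  have "evaluates_to x (gen g) (\<beta> g)" if g: "g \<in> I" for g
  proof -
    consider "g = Prod_gen" | i where "g = Coeff_gen i" "i \<in> {1..<n}"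
      | k i where "g = Moment_gen k i" "k < p" "k \<noteq> 1" "i < n"
      using g by (auto simp: I_def)
    then show ?thesis
    proof cases
      case 1
      then show ?thesis by (auto simp: \<beta>_def \<gamma>_def W_def poly_prod intro!: E.prod T[unfolded t_def])
    next
      case 2
      then show ?thesis
        by (auto simp: \<beta>_def \<gamma>_def coeff simp del: One_nat_def intro!: E.coeff_root_poly U[unfolded t_def])
    next
      case (3 k i)
      then have "\<beta> g = (\<Sum>j\<in>J. z k j * (t j ^ p) ^ i)" by (auto simp: z \<beta>_def \<gamma>_def simp del: One_nat_def)
      with 3 show ?thesis by (auto simp: M_def simp del: One_nat_def intro!: E.sum E.mult E.power U Z)
    qed
  qed
  moreover have "mpoly_eval (\<lambda>c. c) (\<lambda>b. \<beta> (idx b)) P \<noteq> 0" using c by (simp add: \<beta>_def H)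
  ultimately show ?thesis by blast
qed

lemma alg_independent_gens: "alg_independent rf_const (gen ` I)"
  by (rule alg_independent_if_dense_values) (rule gen_values_dense)

end

section \<open>The action of the kernel\<close>

lemma rf_const_power: "rf_const (c ^ k) = rf_const c ^ k"
  by (induction k) (simp_all add: rf_const_hom)

lemma (in group) bij_betw_right_mult:
  "h \<in> carrier G \<Longrightarrow> bij_betw (\<lambda>g. g \<otimes> h) (carrier G) (carrier G)"
  by (rule bij_betwI[where g = "\<lambda>g. g \<otimes> inv h"]) (auto simp: m_assoc)

lemma root_poly_permute: "\<tau> permutes J \<Longrightarrow> root_poly (\<lambda>j. u (\<tau> j)) J = root_poly u J"
  using prod.permute[of \<tau> J "\<lambda>j. [:- u j, 1:]"] by (simp add: root_poly_def o_def)

context wreath_invariants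
begin

abbreviation "G \<equiv> (wreath_product n p)\<lparr>carrier := wreath_kernel n p\<rparr>"

abbreviation "act g \<equiv> perm_act (wreath_perm n p g)"

abbreviation "F \<equiv> adjoin rf_const (gen ` I)"

abbreviation "R \<equiv> monomial_span F T J"

sublocale F: subfield_of F by (rule subfield_of_adjoin)

sublocale R: subring_of R
  by (rule subring_of_monomial_span) (simp_all add: F.subring_of_axioms)

lemma F_R: "c \<in> F \<Longrightarrow> c \<in> R"
  by (rule monomial_span_const[OF F.subring_of_axioms]) simp_all

lemma T_R: "j \<in> J \<Longrightarrow> T j \<in> R"
  by (rule monomial_span_gen[OF F.subring_of_axioms]) simp_all

lemma mem_wreath_kernel:
  "(a, \<tau>) \<in> wreath_kernel n p \<longleftrightarrow>
     a \<in> J \<rightarrow>\<^sub>E {0..<int p} \<and> \<tau> permutes J \<and> (\<Sum>j\<in>J. a j) mod int p = 0"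
  by (auto simp: wreath_kernel_def kernel_def wreath_sum_eq p_pos carrier_wreath_product)

lemma wreath_kernel_carrier: "g \<in> wreath_kernel n p \<Longrightarrow> g \<in> carrier (wreath_product n p)"
  by (simp add: wreath_kernel_def kernel_def)

lemma finite_wreath_kernel: "finite (wreath_kernel n p)"
proof (rule finite_subset)
  show "wreath_kernel n p \<subseteq> (J \<rightarrow>\<^sub>E {0..<int p}) \<times> {\<tau>. \<tau> permutes J}"
    by (auto simp only: mem_wreath_kernel mem_Times_iff mem_Collect_eq fst_conv snd_conv)
  show "finite ((J \<rightarrow>\<^sub>E {0..<int p}) \<times> {\<tau>. \<tau> permutes J})"
    by (intro finite_cartesian_product finite_PiE finite_permutations) auto
qed

lemma subgroup_wreath_kernel: "subgroup (wreath_kernel n p) (wreath_product n p)"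
proof -
  interpret group_hom "wreath_product n p" "integer_mod_group p" "wreath_sum n p"
    by (intro group_hom.intro group_hom_axioms.intro group_wreath_product wreath_sum_hom p_pos) simp
  show ?thesis unfolding wreath_kernel_def by (rule subgroup_kernel)
qed

lemma group_G: "group G"
  by (rule subgroup.subgroup_is_group[OF subgroup_wreath_kernel group_wreath_product[OF p_pos]])

lemma wreath_perm_hom: "wreath_perm n p \<in> hom (wreath_product n p) (sym_group (n * p))"
  using wreath_perm_mon[OF p_pos, of n] by (simp add: mon_def)

lemma inj_wreath_perm: "g \<in> wreath_kernel n p \<Longrightarrow> inj (wreath_perm n p g)"
  using hom_in_carrier[OF wreath_perm_hom wreath_kernel_carrier, of g]
  by (simp add: sym_group_def permutes_inj)

lemma act_one: "act \<one>\<^bsub>G\<^esub> f = f"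
  using hom_one[OF wreath_perm_hom group_wreath_product[OF p_pos] sym_group_is_group]
  by (simp add: sym_group_def perm_act_id)

lemma act_mult:
  assumes "g \<in> wreath_kernel n p" "h \<in> wreath_kernel n p"
  shows "act (g \<otimes>\<^bsub>G\<^esub> h) f = act g (act h f)"
  using hom_mult[OF wreath_perm_hom] wreath_kernel_carrier assms
  by (simp add: sym_group_def perm_act_comp inj_wreath_perm)

section \<open>Action of one kernel element on the Fourier coordinates\<close>

context
  fixes a :: "nat \<Rightarrow> int" and \<tau> :: "nat \<Rightarrow> nat"
  assumes g: "(a, \<tau>) \<in> wreath_kernel n p"
begin

lemma tau_permutes: "\<tau> permutes J"
  using g by (simp add: mem_wreath_kernel)

lemma tau_in: "j \<in> J \<Longrightarrow> \<tau> j \<in> J"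
  using tau_permutes by (simp add: permutes_in_image del: atLeastAtMost_iff)

lemmas inj_act = inj_wreath_perm[OF g]

interpretation A: ring_rel "\<lambda>x y. y = act (a, \<tau>) x"
  by (rule ring_rel_perm_act[OF inj_act])

lemma act_V:
  assumes "j \<in> J" "r < p"
  shows "act (a, \<tau>) (V j r) = V (\<tau> j) ((r + nat (a (\<tau> j))) mod p)"
  using wreath_perm_block[OF wreath_kernel_carrier[OF g] assms]
  by (simp only: V_def perm_act_hom[OF inj_act])

text \<open>Block \<open>j\<close> moves to block \<open>\<tau> j\<close> and is then shifted by
  \<open>a (\<tau> j)\<close>; reindexing the sum by the shift pulls out the scalar.\<close>

lemma act_Y:
  assumes j: "j \<in> J"
  shows "act (a, \<tau>) (Y j k) = rf_const (\<omega> ^ (k * nat (a (\<tau> j)))) * Y (\<tau> j) k"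
proof -
  define s where "s = nat (a (\<tau> j))"
  have root: "inverse \<omega> ^ (k * r) = \<omega> ^ (k * s) * inverse \<omega> ^ (k * ((r + s) mod p))" for r
  proof -
    have "(\<omega> ^ k) ^ ((r + s) mod p) = (\<omega> ^ k) ^ (r + s)"
      by (simp add: unity_root_power_eq_iff[OF p_pos] mod_mult_right_eq flip: power_mult)
    then have "inverse \<omega> ^ (k * ((r + s) mod p)) = inverse \<omega> ^ (k * (r + s))"
      by (simp add: power_mult power_inverse)
    then show ?thesis
      using unity_root_nonzero[OF p_pos] by (simp add: power_inverse power_add ring_distribs)
  qed
  have "act (a, \<tau>) (Y j k) = (\<Sum>r<p. rf_const (inverse \<omega> ^ (k * r)) * V (\<tau> j) ((r + s) mod p))"
    unfolding Y_def
    by (rule A.sum[symmetric]) (simp add: perm_act_hom[OF inj_act] act_V[OF j] s_def)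
  also have "\<dots> = (\<Sum>r<p. rf_const (\<omega> ^ (k * s)) *
      (rf_const (inverse \<omega> ^ (k * ((r + s) mod p))) * V (\<tau> j) ((r + s) mod p)))"
    by (subst root) (simp add: rf_const_hom mult.assoc)
  also have "\<dots> = rf_const (\<omega> ^ (k * s)) * Y (\<tau> j) k"
    unfolding Y_def sum_distrib_left
    by (rule sum.reindex_bij_betw[OF bij_betw_add_mod[OF p_pos]])
  finally show ?thesis by (simp add: s_def)
qed

lemma act_T: "j \<in> J \<Longrightarrow> act (a, \<tau>) (T j) = rf_const (\<omega> ^ nat (a (\<tau> j))) * T (\<tau> j)"
  using act_Y[of j 1] by (simp add: T_def)

lemma act_U: "j \<in> J \<Longrightarrow> act (a, \<tau>) (U j) = U (\<tau> j)"
proof -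
  assume "j \<in> J"
  then have "act (a, \<tau>) (U j) = rf_const ((\<omega> ^ nat (a (\<tau> j))) ^ p) * U (\<tau> j)"
    using A.power[OF refl, of "T j" p] by (simp add: U_def act_T power_mult_distrib rf_const_power)
  also have "(\<omega> ^ nat (a (\<tau> j))) ^ p = 1"
    by (metis mult.commute power_mult power_one unity_root_power_p[OF p_pos])
  finally show ?thesis by (simp add: rf_const_hom)
qed

text \<open>The scalar on \<open>Y j k\<close> is the \<open>k\<close>-th power of the one on
  \<open>T j\<close>, so it cancels in the quotient.\<close>

lemma act_Z: "j \<in> J \<Longrightarrow> act (a, \<tau>) (Z j k) = Z (\<tau> j) k"
proof -
  assume "j \<in> J"
  moreover have "rf_const (\<omega> ^ nat (a (\<tau> j))) \<noteq> 0"
    by (simp add: rf_const_eq_0_iff unity_root_nonzero[OF p_pos])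
  moreover have "rf_const (\<omega> ^ (k * nat (a (\<tau> j)))) = rf_const (\<omega> ^ nat (a (\<tau> j))) ^ k"
    by (simp only: rf_const_power[symmetric] power_mult[symmetric] mult.commute)
  ultimately show ?thesis
    by (simp add: Z_def perm_act_divide inj_act act_Y act_T power_mult_distrib flip: A.power[OF refl])
qed

text \<open>The scalars multiply to \<open>\<omega>\<close> raised to the sum of the
  \<open>a j\<close>, a multiple of \<open>p\<close>: the kernel condition enters here.\<close>

lemma act_W: "act (a, \<tau>) W = W"
proof -
  have a: "(\<Sum>j\<in>J. nat (a j)) mod p = 0"
  proof -
    have "int (\<Sum>j\<in>J. nat (a j)) = (\<Sum>j\<in>J. a j)"
      unfolding of_nat_sum using g by (intro sum.cong) (auto simp: mem_wreath_kernel PiE_def Pi_def)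
    moreover have "(\<Sum>j\<in>J. a j) mod int p = 0" using g by (simp only: mem_wreath_kernel)
    ultimately have "int ((\<Sum>j\<in>J. nat (a j)) mod p) = 0" by (simp only: of_nat_mod)
    then show ?thesis by (simp only: of_nat_eq_0_iff)
  qed
  have "act (a, \<tau>) W = (\<Prod>j\<in>J. rf_const (\<omega> ^ nat (a (\<tau> j))) * T (\<tau> j))"
    unfolding W_def by (rule A.prod[symmetric]) (simp add: act_T)
  also have "\<dots> = (\<Prod>j\<in>J. rf_const (\<omega> ^ nat (a j)) * T j)"
    using prod.permute[OF tau_permutes, of "\<lambda>j. rf_const (\<omega> ^ nat (a j)) * T j"] by (simp add: o_def)
  also have "\<dots> = rf_const (\<omega> ^ (\<Sum>j\<in>J. nat (a j))) * W"
    using ring_rel.prod[OF ring_rel_rf_const, of J _ "\<lambda>j. \<omega> ^ nat (a j)"]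
    by (simp add: prod.distrib W_def power_sum)
  also have "\<omega> ^ (\<Sum>j\<in>J. nat (a j)) = 1"
    using a unity_root_power_mod[OF p_pos, of "\<Sum>j\<in>J. nat (a j)"] by simp
  finally show ?thesis by (simp add: rf_const_hom)
qed

lemma act_coeff: "act (a, \<tau>) (poly.coeff (root_poly U J) i) = poly.coeff (root_poly U J) i"
proof -
  have "act (a, \<tau>) (poly.coeff (root_poly U J) i) = poly.coeff (root_poly (\<lambda>j. U (\<tau> j)) J) i"
    by (rule A.coeff_root_poly[symmetric]) (simp add: act_U)
  then show ?thesis by (simp only: root_poly_permute[OF tau_permutes])
qed

lemma act_M: "act (a, \<tau>) (M k i) = M k i"
proof -
  have "act (a, \<tau>) (M k i) = (\<Sum>j\<in>J. Z (\<tau> j) k * U (\<tau> j) ^ i)"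
    unfolding M_def
    by (rule A.sum[symmetric])
      (simp add: perm_act_hom[OF inj_act] act_Z act_U flip: A.power[OF refl])
  also have "\<dots> = M k i"
    unfolding M_def using sum.permute[OF tau_permutes, of "\<lambda>j. Z j k * U j ^ i"] by (simp add: o_def)
  finally show ?thesis .
qed

lemma act_F: "x \<in> F \<Longrightarrow> act (a, \<tau>) x = x"
proof -
  have "subfield_of {x. act (a, \<tau>) x = x}"
  proof
    show "inverse x \<in> {x. act (a, \<tau>) x = x}" if "x \<in> {x. act (a, \<tau>) x = x}" for x
      using that A.one perm_act_divide[OF inj_act, of 1 x] by (simp add: divide_inverse)
    show "- x \<in> {x. act (a, \<tau>) x = x}" if "x \<in> {x. act (a, \<tau>) x = x}" for x
      using that A.uminus[OF refl, of x] by simp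
  qed (use A.one in \<open>auto simp: perm_act_hom[OF inj_act]\<close>)
  moreover have "act (a, \<tau>) (gen i) = gen i" for i
    by (cases i) (simp_all only: gen.simps act_W act_M act_coeff)
  ultimately have "F \<subseteq> {x. act (a, \<tau>) x = x}"
    by (intro adjoin_subset) (auto simp: perm_act_hom[OF inj_act])
  then show "x \<in> F \<Longrightarrow> act (a, \<tau>) x = x" by blast
qed

lemma act_R: "x \<in> R \<Longrightarrow> act (a, \<tau>) x \<in> R"
proof (induction rule: monomial_span.induct)
  case zero
  then show ?case using A.zero R.zero by simp
next
  case (step c x m)
  have "act (a, \<tau>) (\<Prod>j\<in>J. T j ^ m j) = (\<Prod>j\<in>J. (rf_const (\<omega> ^ nat (a (\<tau> j))) * T (\<tau> j)) ^ m j)"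
    by (rule A.prod[symmetric]) (use A.power[OF refl] act_T in metis)
  then have "act (a, \<tau>) (c * (\<Prod>j\<in>J. T j ^ m j) + x) =
      c * (\<Prod>j\<in>J. (rf_const (\<omega> ^ nat (a (\<tau> j))) * T (\<tau> j)) ^ m j) + act (a, \<tau>) x"
    by (simp only: perm_act_hom[OF inj_act] act_F[OF step.hyps(1)])
  also have "\<dots> \<in> R"
    by (intro R.add R.mult R.prod R.power F_R T_R tau_in adjoin_const step)
  finally show ?case .
qed

end

lemma coeff_root_poly_F: "poly.coeff (root_poly U J) i \<in> F"
proof -
  have gen_F: "gen g \<in> F" if "g \<in> I" for g using that by (auto intro: adjoin_gen)
  consider "i = 0" | "i \<in> {1..<n}" | "i = n" | "i > n" by fastforce
  then show ?thesis
  proof cases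
    case 1
    have "W \<in> F" using gen_F[of Prod_gen] by (simp add: I_def)
    then have "(- 1) ^ n * W ^ p \<in> F" by (intro F.mult F.power F.uminus F.one)
    with 1 show ?thesis by (simp add: coeff_root_poly_0 W_def U_def prod_power_distrib)
  next
    case 2
    then show ?thesis using gen_F[of "Coeff_gen i"] by (auto simp: I_def)
  next
    case 3
    then show ?thesis using lead_coeff_root_poly[of U J] F.one by simp
  next
    case 4
    then show ?thesis using F.zero by (simp add: coeff_eq_0 degree_root_poly)
  qed
qed

lemma M_F: "k < p \<Longrightarrow> k \<noteq> 1 \<Longrightarrow> i < n \<Longrightarrow> M k i \<in> F"
proof -
  assume "k < p" "k \<noteq> 1" "i < n"
  then have "Moment_gen k i \<in> I" by (auto simp: I_def)
  then show ?thesis using adjoin_gen[OF imageI, of _ I gen rf_const] by fastforce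
qed

lemma act_hom: "g \<in> wreath_kernel n p \<Longrightarrow> ring_rel (\<lambda>x y. y = act g x)"
  by (intro ring_rel_perm_act inj_wreath_perm)

section \<open>Traces over the kernel\<close>

text \<open>Right translation by \<open>h\<close> permutes the kernel, so the trace absorbs
  \<open>h\<close>.\<close>

lemma trace_reindex:
  assumes h: "h \<in> wreath_kernel n p"
  shows "(\<Sum>g\<in>wreath_kernel n p. act g (act h x)) = (\<Sum>g\<in>wreath_kernel n p. act g x)"
proof -
  have "bij_betw (\<lambda>g. g \<otimes>\<^bsub>G\<^esub> h) (carrier G) (carrier G)"
    by (rule group.bij_betw_right_mult[OF group_G]) (simp add: h)
  then have "(\<Sum>g\<in>carrier G. act (g \<otimes>\<^bsub>G\<^esub> h) x) = (\<Sum>g\<in>carrier G. act g x)"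
    by (rule sum.reindex_bij_betw)
  moreover have "(\<Sum>g\<in>carrier G. act (g \<otimes>\<^bsub>G\<^esub> h) x) = (\<Sum>g\<in>carrier G. act g (act h x))"
    by (rule sum.cong) (use act_mult[OF _ h] in auto)
  ultimately show ?thesis by simp
qed

text \<open>Shifting block \<open>i\<close> forward and block \<open>j\<close> back is an element of
  the kernel that multiplies the monomial by a root of unity other than 1. Since the trace absorbs
  this element, it must vanish.\<close>

lemma trace_monomial_zero:
  assumes ij: "i \<in> J" "j \<in> J" "m i mod p \<noteq> m j mod p"
  shows "(\<Sum>g\<in>wreath_kernel n p. act g (\<Prod>l\<in>J. T l ^ m l)) = 0"
proof -
  \<comment> \<open>The entry \<open>int p - 1\<close> represents -1 in the carrier
    \<open>{0..<int p}\<close>.\<close>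
  define a where "a = (\<lambda>l\<in>J. if l = i then 1 else if l = j then int p - 1 else 0)"
  have "i \<noteq> j" using ij by auto
  have "(\<Sum>l\<in>J. a l) = (\<Sum>l\<in>{i, j}. if l = i then 1 else int p - 1)"
    using ij by (intro sum.mono_neutral_cong_right) (auto simp: a_def)
  also have "\<dots> = int p" using \<open>i \<noteq> j\<close> by simp
  finally have h: "(a, id) \<in> wreath_kernel n p"
    using p_gt_1 by (simp add: mem_wreath_kernel permutes_id) (auto simp: a_def)
  interpret A: ring_rel "\<lambda>x y. y = act (a, id) x" by (rule act_hom[OF h])
  \<comment> \<open>A natural number congruent to \<open>m i - m j\<close> modulo
    \<open>p\<close>.\<close>
  define e where "e = m i + (p - 1) * m j"
  have "act (a, id) (\<Prod>l\<in>J. T l ^ m l) = (\<Prod>l\<in>J. rf_const ((\<omega> ^ nat (a l)) ^ m l) * T l ^ m l)"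
    by (rule A.prod[symmetric])
      (simp add: act_T[OF h] power_mult_distrib rf_const_power flip: A.power[OF refl])
  also have "\<dots> = rf_const (\<Prod>l\<in>J. (\<omega> ^ nat (a l)) ^ m l) * (\<Prod>l\<in>J. T l ^ m l)"
    using ring_rel.prod[OF ring_rel_rf_const, of J _ "\<lambda>l. (\<omega> ^ nat (a l)) ^ m l"]
    by (simp add: prod.distrib)
  also have "(\<Prod>l\<in>J. (\<omega> ^ nat (a l)) ^ m l) = (\<Prod>l\<in>{i, j}. (\<omega> ^ nat (a l)) ^ m l)"
    using ij by (intro prod.mono_neutral_right) (auto simp: a_def)
  also have "\<dots> = \<omega> ^ e"
  proof -
    have "nat (int p - 1) = p - 1" by simp
    then have "nat (a i) = 1" "nat (a j) = p - 1" using ij \<open>i \<noteq> j\<close> by (simp_all add: a_def)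
    then show ?thesis using \<open>i \<noteq> j\<close> by (simp add: e_def power_add power_mult)
  qed
  finally have act_h: "act (a, id) (\<Prod>l\<in>J. T l ^ m l) = rf_const (\<omega> ^ e) * (\<Prod>l\<in>J. T l ^ m l)" .
  have "\<omega> ^ e \<noteq> 1"
  proof
    assume "\<omega> ^ e = 1"
    then have "\<omega> ^ e * \<omega> ^ m j = \<omega> ^ m j" by simp
    moreover have "e + m j = m i + p * m j" using p_pos by (cases p) (simp_all add: e_def)
    ultimately have "\<omega> ^ (m i + p * m j) = \<omega> ^ m j" by (metis power_add)
    then show False using ij(3) by (simp add: unity_root_power_eq_iff[OF p_pos])
  qed
  let ?tr = "\<Sum>g\<in>wreath_kernel n p. act g (\<Prod>l\<in>J. T l ^ m l)"
  have "?tr = (\<Sum>g\<in>wreath_kernel n p. act g (act (a, id) (\<Prod>l\<in>J. T l ^ m l)))"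
    by (rule trace_reindex[OF h, symmetric])
  also have "\<dots> = rf_const (\<omega> ^ e) * ?tr"
    unfolding act_h sum_distrib_left
    by (rule sum.cong) (simp_all add: perm_act_hom inj_wreath_perm)
  finally have "(1 - rf_const (\<omega> ^ e)) * ?tr = 0" by (simp add: algebra_simps)
  moreover have "rf_const (\<omega> ^ e) \<noteq> 1"
    using \<open>\<omega> ^ e \<noteq> 1\<close> rf_const_eq_iff[of "\<omega> ^ e" 1] by (simp add: rf_const_hom)
  ultimately show ?thesis by simp
qed

text \<open>When all exponents are congruent modulo \<open>p\<close>, the monomial is an invariant
  power of \<open>W\<close> times a monomial in the \<open>U j\<close>, on which only the
  permutations act; the trace is then a symmetric function of the \<open>U j\<close>.\<close>

lemma trace_monomial: "(\<Sum>g\<in>wreath_kernel n p. act g (\<Prod>j\<in>J. T j ^ m j)) \<in> F"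
proof (cases "\<exists>i\<in>J. \<exists>j\<in>J. m i mod p \<noteq> m j mod p")
  case True
  then obtain i j where "i \<in> J" "j \<in> J" "m i mod p \<noteq> m j mod p" by blast
  from trace_monomial_zero[OF this] show ?thesis by (simp only: F.zero)
next
  case False
  define c where "c = m 1 mod p"
  define q where "q j = m j div p" for j
  have m: "m j = c + p * q j" if "j \<in> J" for j
  proof -
    have "1 \<in> J" using n by simp
    then have "m j mod p = c" using False that unfolding c_def by blast
    then show ?thesis by (metis q_def mod_mult_div_eq)
  qed
  have W: "W \<in> F" using adjoin_gen[of "gen Prod_gen" "gen ` I" rf_const] by (simp add: I_def)
  have "(\<Prod>j\<in>J. T j ^ m j) = W ^ c * (\<Prod>j\<in>J. U j ^ q j)"
    by (simp add: m power_add power_mult prod.distrib W_def U_def prod_power_distrib)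
  moreover have "act g (W ^ c * (\<Prod>j\<in>J. U j ^ q j)) = W ^ c * (\<Prod>j\<in>J. U (snd g j) ^ q j)"
    if "g \<in> wreath_kernel n p" for g
  proof -
    obtain a \<tau> where [simp]: "g = (a, \<tau>)" by (cases g)
    have g: "(a, \<tau>) \<in> wreath_kernel n p" using that by simp
    interpret A: ring_rel "\<lambda>x y. y = act (a, \<tau>) x" by (rule act_hom[OF g])
    have "act (a, \<tau>) (\<Prod>j\<in>J. U j ^ q j) = (\<Prod>j\<in>J. U (\<tau> j) ^ q j)"
      by (rule A.prod[symmetric]) (simp add: act_U[OF g] flip: A.power[OF refl])
    moreover have "act (a, \<tau>) (W ^ c) = W ^ c" by (intro act_F[OF g] F.power W)
    ultimately show ?thesis by (simp add: perm_act_hom[OF inj_wreath_perm[OF g]])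
  qed
  ultimately have "(\<Sum>g\<in>wreath_kernel n p. act g (\<Prod>j\<in>J. T j ^ m j)) =
      W ^ c * (\<Sum>g\<in>wreath_kernel n p. \<Prod>j\<in>J. U (snd g j) ^ q j)"
    by (simp add: sum_distrib_left)
  \<comment> \<open>The kernel condition concerns only \<open>a\<close>, so as a set the kernel is a
    product, and the shifts contribute just the factor \<open>card ?A\<close>.\<close>
  also have kernel: "wreath_kernel n p =
      {a. a \<in> J \<rightarrow>\<^sub>E {0..<int p} \<and> (\<Sum>j\<in>J. a j) mod int p = 0} \<times> {\<tau>. \<tau> permutes J}" (is "_ = ?A \<times> ?P")
  proof (rule Set.set_eqI)
    show "g \<in> wreath_kernel n p \<longleftrightarrow> g \<in> ?A \<times> ?P" for g
      by (cases g) (simp only: mem_wreath_kernel mem_Times_iff mem_Collect_eq fst_conv snd_conv, blast)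
  qed
  also have "(\<Sum>g\<in>?A \<times> {\<tau>. \<tau> permutes J}. \<Prod>j\<in>J. U (snd g j) ^ q j) =
      of_nat (card ?A) * (\<Sum>\<tau> | \<tau> permutes J. \<Prod>j\<in>J. U (\<tau> j) ^ q j)"
    by (simp only: sum.cartesian_product' snd_conv sum_constant)
  also have "W ^ c * \<dots> \<in> F"
    by (intro F.mult F.power W F.of_nat F.permutation_sum_mem
        power_sum_mem[OF F.subring_of_axioms] coeff_root_poly_F) simp_all
  finally show ?thesis by (simp only: kernel)
qed

text \<open>The kernel fixes \<open>F\<close>, so the trace is \<open>F\<close>-linear and monomials
  suffice.\<close>

lemma trace_R: "x \<in> R \<Longrightarrow> (\<Sum>g\<in>wreath_kernel n p. act g x) \<in> F"
proof (induction rule: monomial_span.induct)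
  case zero
  have "act g 0 = 0" if "g \<in> wreath_kernel n p" for g
    using ring_rel.zero[OF act_hom[OF that]] by simp
  then show ?case using F.zero by simp
next
  case (step c x m)
  have "act g (c * (\<Prod>j\<in>J. T j ^ m j) + x) = c * act g (\<Prod>j\<in>J. T j ^ m j) + act g x"
    if "g \<in> wreath_kernel n p" for g
    using that act_F[OF _ step.hyps(1)] by (cases g) (simp add: perm_act_hom inj_wreath_perm)
  then have "(\<Sum>g\<in>wreath_kernel n p. act g (c * (\<Prod>j\<in>J. T j ^ m j) + x)) =
      c * (\<Sum>g\<in>wreath_kernel n p. act g (\<Prod>j\<in>J. T j ^ m j)) + (\<Sum>g\<in>wreath_kernel n p. act g x)"
    by (simp add: sum.distrib sum_distrib_left)
  also have "\<dots> \<in> F" by (intro F.add F.mult step trace_monomial)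
  finally show ?case .
qed

section \<open>The function field as fractions of \<open>R\<close>, and the fixed field\<close>

text \<open>For \<open>k \<noteq> 1\<close> the moments \<open>M k i\<close>, which lie in
  \<open>F\<close>, determine \<open>Z j k\<close> after division by the nonzero \<open>?D\<close>,
  and hence \<open>Y j k\<close>; Fourier inversion then yields the variables.\<close>

lemma rf_field_fractions: "rf_field (n * p) \<subseteq> {x. \<exists>a b. a \<in> R \<and> b \<in> R \<and> b \<noteq> 0 \<and> x = a / b}"
  (is "_ \<subseteq> ?K")
proof -
  interpret K: subfield_of ?K by (rule subfield_of_fractions[OF R.subring_of_axioms])
  have R_K: "x \<in> ?K" if "x \<in> R" for x
    using that R.one by (intro CollectI exI[of _ x] exI[of _ 1]) simp
  have const_K: "rf_const c \<in> ?K" for c by (intro R_K F_R adjoin_const)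
  have U_R: "U j \<in> R" if "j \<in> J" for j unfolding U_def by (intro R.power T_R that)
  have Y_K: "Y j k \<in> ?K" if j: "j \<in> J" and k: "k < p" for j k
  proof (cases "k = 1")
    case True
    then show ?thesis using R_K[OF T_R[OF j]] by (simp only: T_def)
  next
    case False
    let ?B = "root_poly U (J - {j})"
    let ?D = "poly ?B (U j)"
    \<comment> \<open>By synthetic division these are polynomials in \<open>U j\<close> with
      coefficients in \<open>F\<close>.\<close>
    have B: "poly.coeff ?B i \<in> R" for i
      using coeff_root_poly_remove[of J j U i] j
      by (simp only: finite_atLeastAtMost) (intro R.sum R.mult R.power U_R F_R coeff_root_poly_F)
    have D: "?D \<in> R" "?D \<noteq> 0"
    proof -
      show "?D \<in> R" unfolding poly_altdef by (intro R.sum R.mult R.power B U_R j)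
      show "?D \<noteq> 0" by (rule root_poly_remove_nonzero[OF _ j inj_on_U]) simp
    qed
    have "Z j k * ?D = (\<Sum>i<n. poly.coeff ?B i * M k i)"
      using vandermonde_left_inverse[OF _ j, of U "\<lambda>l. Z l k"] by (simp add: M_def)
    also have "\<dots> \<in> R" using False k by (intro R.sum R.mult B F_R M_F) auto
    finally have "(Z j k * ?D) / ?D * T j ^ k \<in> ?K"
      using D(1) T_R[OF j] by (intro K.mult K.divide K.power R_K)
    also have "(Z j k * ?D) / ?D * T j ^ k = Y j k" using D(2) T_nonzero[OF j] by (simp add: Z_def)
    finally show ?thesis .
  qed
  have "rf_var i \<in> ?K" if i_in: "i \<in> {1..n * p}" for i
  proof -
    obtain j r where i: "j \<in> J" "r < p" "i = (j - 1) * p + r + 1"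
      by (rule block_elem_cases[OF i_in])
    have "V j r \<in> ?K"
      unfolding V_eq_Y[OF i(2)]
      by (intro K.divide K.sum K.mult const_K K.of_nat Y_K i(1)) simp
    then show ?thesis by (simp only: V_def i(3))
  qed
  then show ?thesis
    unfolding rf_field_def using const_K
    by (intro adjoin_subset[OF K.subfield_of_axioms]) auto
qed

lemma gen_rf_field: "gen i \<in> rf_field (n * p)"
proof -
  interpret L: subfield_of "rf_field (n * p)"
    unfolding rf_field_def by (rule subfield_of_adjoin)
  have V: "V j r \<in> rf_field (n * p)" if "j \<in> J" "r < p" for j r
    using block_elem(1)[OF that] unfolding V_def rf_field_def by (intro adjoin_gen imageI)
  have Y: "Y j k \<in> rf_field (n * p)" if "j \<in> J" for j k
    unfolding Y_def by (intro L.sum L.mult V that) (simp_all add: rf_field_def adjoin_const)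
  have T: "T j \<in> rf_field (n * p)" if "j \<in> J" for j
    unfolding T_def by (intro Y that)
  have U: "U j \<in> rf_field (n * p)" if "j \<in> J" for j
    unfolding U_def by (intro L.power T that)
  \<comment> \<open>Membership as a relation that ignores its second argument, so that transport of
    coefficients applies.\<close>
  have L_rel: "ring_rel (\<lambda>x (_ :: ratfun). x \<in> rf_field (n * p))"
    by unfold_locales (simp_all add: L.zero L.one L.add L.uminus L.mult)
  have coeff: "poly.coeff (root_poly U J) k \<in> rf_field (n * p)" for k
    by (rule ring_rel.coeff_root_poly[OF L_rel U])
  show ?thesis
    by (cases i; simp only: gen.simps W_def M_def Z_def)
      (intro L.prod L.sum L.mult L.divide L.power T U Y coeff; assumption)+
qed

text \<open>An invariant is a fraction over \<open>R\<close>, which the trace argument puts into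
  \<open>F\<close>; conversely, the kernel fixes \<open>F\<close>, and the generators are rational
  functions of the variables.\<close>

lemma fixed_field_eq: "fixed_field (wreath_perm n p ` wreath_kernel n p) (rf_field (n * p)) = F"
proof
  show "fixed_field (wreath_perm n p ` wreath_kernel n p) (rf_field (n * p)) \<subseteq> F"
  proof
    fix f assume "f \<in> fixed_field (wreath_perm n p ` wreath_kernel n p) (rf_field (n * p))"
    then have f: "f \<in> rf_field (n * p)" "\<And>g. g \<in> wreath_kernel n p \<Longrightarrow> act g f = f"
      by (auto simp: fixed_field_def)
    then obtain a b where ab: "a \<in> R" "b \<in> R" "b \<noteq> 0" "f = a / b"
      using rf_field_fractions by blast
    have "wreath_kernel n p \<noteq> {}"
      using subgroup.one_closed[OF subgroup_wreath_kernel] by blast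
    then have "card (wreath_kernel n p) \<noteq> 0" using finite_wreath_kernel by simp
    \<comment> \<open>Characteristic zero, inherited from the complex constants.\<close>
    then have card: "of_nat (card (wreath_kernel n p)) \<noteq> (0 :: ratfun)"
      using rf_const_eq_0_iff[of "of_nat (card (wreath_kernel n p))"] by (simp add: rf_const_of_nat)
    have "a / b \<in> F"
    proof (rule invariant_fraction_mem[OF group_G, where act = act and R = R])
      show "finite (carrier G)" "of_nat (card (carrier G)) \<noteq> (0 :: ratfun)"
        by (simp_all add: finite_wreath_kernel card)
      show "act \<one>\<^bsub>G\<^esub> x = x" for x by (rule act_one)
      show "act (g \<otimes>\<^bsub>G\<^esub> h) x = act g (act h x)" if "g \<in> carrier G" "h \<in> carrier G" for g h x
        using that by (intro act_mult) simp_all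
      show "ring_rel (\<lambda>x y. y = act g x)" if "g \<in> carrier G" for g
        using that by (intro act_hom) simp
      show "act g x \<in> R" if "g \<in> carrier G" "x \<in> R" for g x
        using that act_R by (cases g) simp
      show "(\<Sum>g\<in>carrier G. act g x) \<in> F" if "x \<in> R" for x
        using trace_R[OF that] by simp
      show "act g (a / b) = a / b" if "g \<in> carrier G" for g
        using f(2)[of g] that ab(4) by simp
    qed (fact F.subfield_of_axioms R.subring_of_axioms ab)+
    with ab show "f \<in> F" by simp
  qed
  have "F \<subseteq> rf_field (n * p)"
    using gen_rf_field unfolding rf_field_def
    by (intro adjoin_subset[OF subfield_of_adjoin] image_subsetI) (simp_all add: adjoin_const)
  moreover have "act g x = x" if "g \<in> wreath_kernel n p" "x \<in> F" for g x
    using that act_F by (cases g) simp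
  ultimately show "F \<subseteq> fixed_field (wreath_perm n p ` wreath_kernel n p) (rf_field (n * p))"
    unfolding fixed_field_def by blast
qed

end

theorem theorem5:
  fixes n p :: nat
  assumes "n \<ge> 1" and "prime p"
  shows "rational_extension rf_const
           (fixed_field (wreath_perm n p ` wreath_kernel n p) (rf_field (n * p)))"
proof -
  interpret wreath_invariants n p by unfold_locales (fact assms)+
  show ?thesis
    unfolding rational_extension_def finitely_generated_extension_def
      purely_transcendental_extension_def fixed_field_eq
    by (intro conjI exI[of _ "gen ` I"] finite_imageI finite_I alg_independent_gens refl)
qed

end
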